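(* Let $P\subset\mathbb{R}^d$ be a $d$-dimensional integrally closed lattice polytope and let $n:=|P\cap\mathbb{Z}^d|$. Then $$d!\,\mathrm{vol}(P)\leq \binom{n-1}{d}.$$
   Context: A lattice polytope $P\subset\mathbb{R}^d$ is the convex hull of finitely many points of $\mathbb{Z}^d$. $P$ is called integrally closed if for every positive integer $c$ and every $z\in cP\cap\mathbb{Z}^d$ there exist $x_1,\ldots,x_c\in P\cap\mathbb{Z}^d$ with $\sum_{i=1}^c x_i=z$. Here $\mathrm{vol}$ denotes the usual $d$-dimensional (Lebesgue) volume. *)

theory Defs
  imports "HOL-Analysis.Analysis"
begin

definition int_points :: "(real ^ 'd) set" where
  "int_points = {x. \<forall>i. x $ i \<in> \<int>}"

definition lattice_polytope :: "(real ^ 'd) set \<Rightarrow> bool" where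
  "lattice_polytope P \<longleftrightarrow>
     (\<exists>S. finite S \<and> S \<subseteq> int_points \<and> P = convex hull S)"

text \<open>The lattice points \<open>x 1, \<dots>, x c\<close> need not be distinct.\<close>

definition integrally_closed :: "(real ^ 'd) set \<Rightarrow> bool" where
  "integrally_closed P \<longleftrightarrow>
     (\<forall>c::nat. c > 0 \<longrightarrow>
        (\<forall>z \<in> ((*\<^sub>R) (real c) ` P) \<inter> int_points.
           \<exists>x :: nat \<Rightarrow> real ^ 'd.
             (\<forall>i \<in> {1..c}. x i \<in> P \<inter> int_points) \<and> (\<Sum>i = 1..c. x i) = z))"

end

theory Submission
  imports Defs "HOL-Library.Poly_Mapping" "HOL-Library.Z2" "HOL-Algebra.Algebraic_Closure_Type"
    "HOL-Real_Asymp.Real_Asymp"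
begin

text \<open>
  Let \<open>R\<close> be the semigroup algebra of the cone over \<open>P\<close>, over an algebraically closed field of
  characteristic 2. Its degree \<open>c\<close> part has the lattice points of \<open>c P\<close> as a basis, so its
  dimension is asymptotic to \<open>vol(P) c^d\<close>, and by hypothesis \<open>R\<close> is generated by its degree 1
  part, of dimension \<open>n\<close>. Noether normalization yields a basis \<open>b 0, \<dots>, b (n - 1)\<close> of that part
  such that \<open>R\<close> is finite over the subalgebra generated by \<open>b 0, \<dots>, b d\<close>.

  The crucial point is that every element of degree greater than \<open>d\<close> lies in the ideal \<open>J\<close>
  generated by \<open>b 0, \<dots>, b d\<close>. This replaces the Cohen-Macaulay property and is a tight closure
  argument: if \<open>x\<close> is a monomial of degree \<open>c + 1 > d\<close>, \<open>y\<close> is a monomial of a fixed large degree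
  and \<open>q\<close> is a power of 2, then the pigeonhole principle puts \<open>x^q y\<close> into the ideal generated by
  the powers \<open>(b i)^q\<close>. A \<open>q\<close>-th root map adapted to \<open>y\<close> sends \<open>x^q y\<close> to \<open>x\<close> and that ideal
  into \<open>J\<close>; it maps into \<open>R\<close> because \<open>P\<close> is closed and \<open>q\<close> is large.

  So \<open>R\<close> is spanned by the monomials in the \<open>b i\<close> having degree at most \<open>d\<close> in the \<open>n - d - 1\<close>
  variables \<open>b i\<close> with \<open>i > d\<close>. There are at most \<open>binom(n - 1, d) binom(c + d, d)\<close> of them in
  degree \<open>c\<close>, and comparing the leading terms in \<open>c\<close> gives the bound.
\<close>

section \<open>Linear relations, and points where a polynomial does not vanish\<close>

text \<open>The relation is indexed by \<open>E\<close> and not by its image, since \<open>f\<close>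
  need not be injective: a collision \<open>f x = f y\<close> is itself a relation with coefficients
  1 and -1. Without collisions the image is too large to be independent.\<close>

lemma (in vector_space) linear_relation_of_card:
  assumes "finite E" "finite T" "f ` E \<subseteq> span T" "card T < card E"
  shows "\<exists>c. (\<exists>e\<in>E. c e \<noteq> 0) \<and> (\<Sum>e\<in>E. scale (c e) (f e)) = 0"
proof (cases "inj_on f E")
  case True
  have "dependent (f ` E)"
    using independent_span_bound[OF assms(2) _ assms(3)] card_image[OF True] assms(4) by auto
  then obtain u where u: "\<exists>v\<in>f ` E. u v \<noteq> 0" "(\<Sum>v\<in>f ` E. scale (u v) v) = 0"
    using dependent_finite[of "f ` E"] assms(1) by auto
  show ?thesis
    using u by (intro exI[of _ "u \<circ> f"]) (auto simp: sum.reindex[OF True])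
next
  case False
  then obtain x y where xy: "x \<in> E" "y \<in> E" "x \<noteq> y" "f x = f y"
    by (auto simp: inj_on_def)
  define c where "c e = (if e = x then 1 else if e = y then - 1 else (0::'a))" for e
  have "(\<Sum>e\<in>E. scale (c e) (f e)) = (\<Sum>e\<in>{x, y}. scale (c e) (f e))"
    using assms(1) xy by (intro sum.mono_neutral_right) (auto simp: c_def)
  also have "\<dots> = 0"
    using xy by (simp add: c_def)
  finally show ?thesis
    using xy by (intro exI[of _ c]) (auto simp: c_def)
qed

text \<open>For nonconstant \<open>p\<close>, a root of \<open>p + 1\<close> is a point where
  \<open>p\<close> takes the value -1.\<close>

lemma exists_nonroot:
  fixes p :: "'k::alg_closed_field poly"
  assumes "p \<noteq> 0"
  shows "\<exists>x. poly p x \<noteq> 0"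
proof (cases "Polynomial.degree p = 0")
  case True
  then obtain a where "p = [:a:]" by (metis degree_eq_zeroE)
  then show ?thesis using assms by auto
next
  case False
  then have "Polynomial.degree (p + 1) > 0"
    by (metis degree_1 degree_add_eq_left neq0_conv)
  then obtain x where "poly (p + 1) x = 0"
    using alg_closed_imp_poly_has_root by blast
  then have "poly p x = - 1" by (simp add: eq_neg_iff_add_eq_0)
  then show ?thesis by (metis neg_equal_0_iff_equal one_neq_zero)
qed

text \<open>\<open>E\<close> is a set of exponent vectors; telling them apart by their first
  \<open>m\<close> entries keeps different monomials from merging. For the induction on
  \<open>m\<close>, fix the last exponent of a term with nonzero coefficient, choose the other
  values so that the coefficient of this power of the last variable survives, and finish with the
  one-variable case.\<close>

lemma exists_nonroot_multivariate:
  fixes c :: "(nat \<Rightarrow> nat) \<Rightarrow> 'k::alg_closed_field"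
  assumes "finite E" "\<exists>\<alpha>\<in>E. c \<alpha> \<noteq> 0"
    and "\<And>\<alpha> \<beta>. \<alpha> \<in> E \<Longrightarrow> \<beta> \<in> E \<Longrightarrow> (\<forall>i<m. \<alpha> i = \<beta> i) \<Longrightarrow> \<alpha> = \<beta>"
  shows "\<exists>l. (\<Sum>\<alpha>\<in>E. c \<alpha> * (\<Prod>i<m. l i ^ \<alpha> i)) \<noteq> 0"
  using assms
proof (induction m arbitrary: E)
  case 0
  then obtain a where a: "a \<in> E" "c a \<noteq> 0" by auto
  then have "E = {a}" using 0(3) by auto
  then show ?case using a by simp
next
  case (Suc m)
  obtain e where e: "e \<in> E" "c e \<noteq> 0" using Suc.prems(2) by auto
  define E' where "E' = {\<alpha>\<in>E. \<alpha> m = e m}"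
  have "\<exists>l. (\<Sum>\<alpha>\<in>E'. c \<alpha> * (\<Prod>i<m. l i ^ \<alpha> i)) \<noteq> 0"
  proof (rule Suc.IH)
    show "finite E'" using Suc.prems(1) by (auto simp: E'_def)
    show "\<exists>\<alpha>\<in>E'. c \<alpha> \<noteq> 0" using e by (auto simp: E'_def)
    show "\<alpha> = \<beta>" if "\<alpha> \<in> E'" "\<beta> \<in> E'" "\<forall>i<m. \<alpha> i = \<beta> i" for \<alpha> \<beta>
      using that Suc.prems(3)[of \<alpha> \<beta>] by (auto simp: E'_def less_Suc_eq)
  qed
  then obtain l where l: "(\<Sum>\<alpha>\<in>E'. c \<alpha> * (\<Prod>i<m. l i ^ \<alpha> i)) \<noteq> 0" by auto
  define p where "p = (\<Sum>\<alpha>\<in>E. Polynomial.monom (c \<alpha> * (\<Prod>i<m. l i ^ \<alpha> i)) (\<alpha> m))"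
  have "Polynomial.coeff p (e m) = (\<Sum>\<alpha>\<in>E'. c \<alpha> * (\<Prod>i<m. l i ^ \<alpha> i))"
    unfolding p_def E'_def coeff_sum coeff_monom
    using Suc.prems(1) by (intro sum.mono_neutral_cong_right) auto
  then have "p \<noteq> 0" using l by auto
  then obtain x where x: "poly p x \<noteq> 0" using exists_nonroot by blast
  have "poly p x = (\<Sum>\<alpha>\<in>E. c \<alpha> * (\<Prod>i<Suc m. (l(m := x)) i ^ \<alpha> i))"
    by (simp add: p_def poly_sum poly_monom mult.assoc)
  then show ?case using x by (intro exI[of _ "l(m := x)"]) metis
qed

section \<open>The semigroup algebra as a vector space\<close>

text \<open>Scalars act through multiplication by these constants, so a linear combination is an
  ordinary ring expression and ring identities apply to it directly.\<close>

definition const :: "'k::zero \<Rightarrow> ('a::zero \<Rightarrow>\<^sub>0 'k)" where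
  "const a = Poly_Mapping.single 0 a"

lemma const_0 [simp]: "const 0 = 0"
  and const_1 [simp]: "const 1 = 1"
  by (simp_all add: const_def)

lemma const_add: "const (a + b) = const a + const b"
  by (simp add: const_def single_add)

lemma const_minus: "const (- a) = - const a"
  by (simp add: const_def single_uminus)

lemma const_mult: "const (a * b) = const a * const b"
  by (simp add: const_def mult_single)

lemma const_sum: "const (sum f A) = (\<Sum>x\<in>A. const (f x))" for f :: "'i \<Rightarrow> 'k::comm_monoid_add"
  by (induction A rule: infinite_finite_induct) (auto simp: const_add)

interpretation pm: vector_space
  "\<lambda>(a::'k::field) (f::'a::comm_monoid_add \<Rightarrow>\<^sub>0 'k). const a * f"
  by standard (auto simp: algebra_simps const_add const_mult)

text \<open>Here this rule undoes \<open>const_mult\<close> and makes the simplifier loop.\<close>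
declare pm.scale_scale [simp del]

lemma lookup_const_mult: "Poly_Mapping.lookup (const a * f) z = a * Poly_Mapping.lookup f z"
  for f :: "'a::comm_monoid_add \<Rightarrow>\<^sub>0 'k::comm_ring_1"
  unfolding const_def mult_map_scale_conv_mult[symmetric]
  by (simp add: Poly_Mapping.map.rep_eq when_def)

lemma poly_mapping_eq_sum_single:
  "f = (\<Sum>z\<in>Poly_Mapping.keys f. Poly_Mapping.single z (Poly_Mapping.lookup f z))"
  by (rule poly_mapping_eqI) (simp add: lookup_sum lookup_single when_def in_keys_iff)

lemma single_eq_const_mult: "Poly_Mapping.single z a = const a * Poly_Mapping.single z 1"
  for a :: "'k::comm_semiring_1"
  by (simp add: const_def mult_single)

section \<open>Graded pieces of the algebra and of its ideals\<close>

text \<open>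
  The degree \<open>c\<close> part of the semigroup algebra, with the degree left out of the exponents:
  an element may lie in several pieces, and all products are taken in one Laurent polynomial ring.
\<close>
definition piece :: "(real^'d) set \<Rightarrow> nat \<Rightarrow> ((real^'d) \<Rightarrow>\<^sub>0 'k::zero) set" where
  "piece P c = {f. Poly_Mapping.keys f \<subseteq> (*\<^sub>R) (real c) ` P \<inter> int_points}"

text \<open>
  For a set \<open>B\<close> of elements of degree 1, the degree \<open>c\<close> part of the ideal generated by \<open>B\<close>;
  it is zero for \<open>c = 0\<close>.
\<close>
definition ideal_piece ::
    "(real^'d) set \<Rightarrow> ((real^'d) \<Rightarrow>\<^sub>0 'k) set \<Rightarrow> nat \<Rightarrow> ((real^'d) \<Rightarrow>\<^sub>0 'k::field) set" where
  "ideal_piece P B c = pm.span {b * h | b h j. b \<in> B \<and> h \<in> piece P j \<and> c = Suc j}"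

lemma int_points_add: "x \<in> int_points \<Longrightarrow> y \<in> int_points \<Longrightarrow> x + y \<in> int_points"
  and int_points_diff: "x \<in> int_points \<Longrightarrow> y \<in> int_points \<Longrightarrow> x - y \<in> int_points"
  and int_points_scale: "x \<in> int_points \<Longrightarrow> real k *\<^sub>R x \<in> int_points"
  and int_points_0: "0 \<in> int_points"
  by (auto simp: int_points_def)

lemma scaled_convex_add:
  fixes P :: "'a::real_vector set"
  assumes "convex P" "x \<in> (*\<^sub>R) (real a) ` P" "y \<in> (*\<^sub>R) (real b) ` P"
  shows "x + y \<in> (*\<^sub>R) (real (a + b)) ` P"
proof (cases "a + b = 0")
  case True
  then show ?thesis using assms by auto
next
  case False
  obtain p q where pq: "p \<in> P" "q \<in> P" "x = real a *\<^sub>R p" "y = real b *\<^sub>R q"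
    using assms by auto
  define r where "r = (real a / real (a + b)) *\<^sub>R p + (real b / real (a + b)) *\<^sub>R q"
  have ab: "real a + real b \<noteq> 0" using False by linarith
  have "real a / real (a + b) + real b / real (a + b) = 1"
    using ab by (simp flip: add_divide_distrib)
  then have "r \<in> P" unfolding r_def
    using pq by (intro convexD[OF assms(1)]) auto
  moreover have "x + y = real (a + b) *\<^sub>R r"
    using ab by (simp add: r_def pq scaleR_add_right)
  ultimately show ?thesis by auto
qed

lemma subspace_piece: "pm.subspace (piece P c :: ((real^'d) \<Rightarrow>\<^sub>0 'k::field) set)"
proof (rule pm.subspaceI)
  show "f + g \<in> piece P c" if "f \<in> piece P c" "g \<in> piece P c" for f g :: "(real^'d) \<Rightarrow>\<^sub>0 'k"
    using that Poly_Mapping.keys_add[of f g] unfolding piece_def by blast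
  show "const a * f \<in> piece P c" if "f \<in> piece P c" for a and f :: "(real^'d) \<Rightarrow>\<^sub>0 'k"
    using that unfolding piece_def by (auto simp: in_keys_iff lookup_const_mult subset_eq)
qed (simp add: piece_def)

lemma single_in_piece:
  "z \<in> (*\<^sub>R) (real c) ` P \<inter> int_points \<Longrightarrow> Poly_Mapping.single z a \<in> piece P c"
  by (auto simp: piece_def)

lemma mult_in_piece:
  fixes f g :: "(real^'d) \<Rightarrow>\<^sub>0 'k::field"
  assumes "convex P" "f \<in> piece P a" "g \<in> piece P b"
  shows "f * g \<in> piece P (a + b)"
proof -
  have "x + y \<in> (*\<^sub>R) (real (a + b)) ` P \<inter> int_points"
    if "x \<in> Poly_Mapping.keys f" "y \<in> Poly_Mapping.keys g" for x y
    using that assms scaled_convex_add[OF assms(1), of x a y b] int_points_add[of x y]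
    unfolding piece_def by blast
  then show ?thesis
    using keys_mult[of f g] unfolding piece_def by blast
qed

lemma one_in_piece: "P \<noteq> {} \<Longrightarrow> 1 \<in> piece P 0" for P :: "(real^'d) set"
  by (auto simp: piece_def int_points_0 image_constant_conv)

lemma power_in_piece:
  fixes f :: "(real^'d) \<Rightarrow>\<^sub>0 'k::field"
  assumes "convex P" "P \<noteq> {}" "f \<in> piece P a"
  shows "f ^ k \<in> piece P (k * a)"
  using assms by (induction k) (auto intro: one_in_piece mult_in_piece)

lemma piece_eq_span:
  "piece P c = pm.span ((\<lambda>z. Poly_Mapping.single z (1::'k::field)) ` ((*\<^sub>R) (real c) ` P \<inter> int_points))"
  (is "_ = pm.span ?M")
proof
  show "piece P c \<subseteq> pm.span ?M"
  proof
    fix f :: "(real^'a) \<Rightarrow>\<^sub>0 'k" assume f: "f \<in> piece P c"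
    have "(\<Sum>z\<in>Poly_Mapping.keys f. const (Poly_Mapping.lookup f z) * Poly_Mapping.single z 1) \<in> pm.span ?M"
      using f by (intro pm.span_sum pm.span_scale pm.span_base) (auto simp: piece_def)
    also have "(\<Sum>z\<in>Poly_Mapping.keys f. const (Poly_Mapping.lookup f z) * Poly_Mapping.single z 1) = f"
      unfolding single_eq_const_mult[symmetric] by (rule poly_mapping_eq_sum_single[symmetric])
    finally show "f \<in> pm.span ?M" .
  qed
  show "pm.span ?M \<subseteq> piece P c"
    by (rule pm.span_minimal[OF _ subspace_piece]) (auto intro: single_in_piece)
qed

lemma subspace_ideal_piece: "pm.subspace (ideal_piece P B c)"
  unfolding ideal_piece_def by (rule pm.subspace_span)

lemma ideal_piece_base: "b \<in> B \<Longrightarrow> h \<in> piece P j \<Longrightarrow> b * h \<in> ideal_piece P B (Suc j)"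
  unfolding ideal_piece_def by (rule pm.span_base) auto

lemma ideal_piece_mult:
  fixes f g :: "(real^'d) \<Rightarrow>\<^sub>0 'k::field"
  assumes "convex P" "f \<in> ideal_piece P B a" "g \<in> piece P b"
  shows "f * g \<in> ideal_piece P B (a + b)"
  using assms(2) unfolding ideal_piece_def[of P B a]
proof (induction rule: pm.span_induct_alt)
  case base
  show ?case using pm.subspace_0[OF subspace_ideal_piece] by simp
next
  case (step c x y)
  obtain b' h j where x: "x = b' * h" "b' \<in> B" "h \<in> piece P j" "a = Suc j" using step by auto
  have "x * g \<in> ideal_piece P B (a + b)"
    using ideal_piece_base[OF x(2) mult_in_piece[OF assms(1) x(3) assms(3)]] x
    by (simp add: mult.assoc)
  then have "const c * (x * g) + y * g \<in> ideal_piece P B (a + b)"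
    using step by (intro pm.subspace_add pm.subspace_scale subspace_ideal_piece)
  then show ?case by (simp add: algebra_simps)
qed

lemma ideal_piece_subset_piece:
  fixes B :: "((real^'d) \<Rightarrow>\<^sub>0 'k::field) set"
  assumes "convex P" "B \<subseteq> piece P 1"
  shows "ideal_piece P B c \<subseteq> piece P c"
  unfolding ideal_piece_def
proof (rule pm.span_minimal[OF _ subspace_piece], safe)
  fix b h :: "(real^'d) \<Rightarrow>\<^sub>0 'k" and j assume "b \<in> B" "h \<in> piece P j"
  then show "b * h \<in> piece P (Suc j)"
    using mult_in_piece[OF assms(1), of b 1 h j] assms(2) by auto
qed

text \<open>Congruences modulo the ideal can be multiplied, by the usual telescoping of a difference
  of products.\<close>

lemma ideal_piece_cong_mult:
  fixes B :: "((real^'d) \<Rightarrow>\<^sub>0 'k::field) set"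
  assumes P: "convex P" "P \<noteq> {}" and B: "B \<subseteq> piece P 1" and y: "y \<in> piece P 1"
    and x1: "x1 - const s1 * y ^ k1 \<in> ideal_piece P B k1"
    and x2: "x2 - const s2 * y ^ k2 \<in> ideal_piece P B k2"
  shows "x1 * x2 - const (s1 * s2) * y ^ (k1 + k2) \<in> ideal_piece P B (k1 + k2)"
proof -
  have yk: "const s * y ^ k \<in> piece P k" for s k
    using pm.subspace_scale[OF subspace_piece power_in_piece[OF P y]] by simp
  \<comment> \<open>The congruence places \<open>x2\<close> in degree \<open>k2\<close>, because
    both the ideal part and the power of \<open>y\<close> lie there; the ideal can then absorb
    \<open>x2\<close> as a factor.\<close>
  have "(x2 - const s2 * y ^ k2) + const s2 * y ^ k2 \<in> piece P k2"
    using ideal_piece_subset_piece[OF P(1) B] x2 yk by (intro pm.subspace_add subspace_piece) auto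
  then have "x2 \<in> piece P k2" by simp
  then have "(x1 - const s1 * y ^ k1) * x2 \<in> ideal_piece P B (k1 + k2)"
    using ideal_piece_mult[OF P(1) x1] by blast
  moreover have "(x2 - const s2 * y ^ k2) * (const s1 * y ^ k1) \<in> ideal_piece P B (k1 + k2)"
    using ideal_piece_mult[OF P(1) x2 yk] by (simp add: add.commute)
  ultimately have "(x1 - const s1 * y ^ k1) * x2 + (x2 - const s2 * y ^ k2) * (const s1 * y ^ k1)
      \<in> ideal_piece P B (k1 + k2)"
    by (intro pm.subspace_add subspace_ideal_piece)
  moreover have "(x1 - c1 * y1) * x2 + (x2 - c2 * y2) * (c1 * y1) = x1 * x2 - c1 * c2 * (y1 * y2)"
    for c1 c2 y1 y2 :: "(real^'d) \<Rightarrow>\<^sub>0 'k"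
    by (simp add: algebra_simps)
  ultimately show ?thesis by (simp only: power_add const_mult)
qed

lemma ideal_piece_cong_power:
  fixes B :: "((real^'d) \<Rightarrow>\<^sub>0 'k::field) set"
  assumes P: "convex P" "P \<noteq> {}" and B: "B \<subseteq> piece P 1" and y: "y \<in> piece P 1"
    and x: "x - const s * y \<in> ideal_piece P B 1"
  shows "x ^ k - const (s ^ k) * y ^ k \<in> ideal_piece P B k"
proof (induction k)
  case 0
  then show ?case using pm.subspace_0[OF subspace_ideal_piece] by simp
next
  case (Suc k)
  show ?case using ideal_piece_cong_mult[OF P B y _ Suc, of x s 1] x by simp
qed

lemma ideal_piece_cong_prod:
  fixes B :: "((real^'d) \<Rightarrow>\<^sub>0 'k::field) set"
  assumes P: "convex P" "P \<noteq> {}" and B: "B \<subseteq> piece P 1" and y: "y \<in> piece P 1"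
    and "finite I" and x: "\<And>i. i \<in> I \<Longrightarrow> x i - const (s i) * y \<in> ideal_piece P B 1"
  shows "(\<Prod>i\<in>I. x i ^ \<alpha> i) - const (\<Prod>i\<in>I. s i ^ \<alpha> i) * y ^ sum \<alpha> I \<in> ideal_piece P B (sum \<alpha> I)"
  using assms(5) x
proof (induction I)
  case empty
  then show ?case using pm.subspace_0[OF subspace_ideal_piece] by simp
next
  case (insert j I)
  show ?case
    using ideal_piece_cong_mult[OF P B y ideal_piece_cong_power[OF P B y] insert.IH, of "x j" "s j" "\<alpha> j"]
      insert by simp
qed

section \<open>Noether normalization\<close>

text \<open>
  Substituting \<open>b i = b' i + l i * b m\<close> in the relation turns it, modulo the \<open>b' i\<close>, into a scalar
  multiple of \<open>b m ^ e\<close>, the scalar being the value of the relation at \<open>l\<close>. A non-root \<open>l\<close> therefore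
  makes \<open>b m\<close> nilpotent modulo the \<open>b' i\<close>.
\<close>
lemma noether_normalization_step:
  fixes b :: "nat \<Rightarrow> ((real^'d) \<Rightarrow>\<^sub>0 'k::alg_closed_field)"
  assumes P: "convex P" "P \<noteq> {}" and b: "\<And>i. i \<le> m \<Longrightarrow> b i \<in> piece P 1"
    and E: "finite E" "\<And>\<alpha>. \<alpha> \<in> E \<Longrightarrow> (\<Sum>i\<le>m. \<alpha> i) = e" "\<And>\<alpha> i. \<alpha> \<in> E \<Longrightarrow> i > m \<Longrightarrow> \<alpha> i = 0"
    and c: "\<exists>\<alpha>\<in>E. c \<alpha> \<noteq> 0" "(\<Sum>\<alpha>\<in>E. const (c \<alpha>) * (\<Prod>i\<le>m. b i ^ \<alpha> i)) = 0"
    and M: "\<And>r. r \<ge> M \<Longrightarrow> piece P (Suc r) \<subseteq> ideal_piece P (b ` {..m}) (Suc r)"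
  shows "\<exists>l. \<forall>r\<ge>M + e. piece P (Suc r) \<subseteq> ideal_piece P ((\<lambda>i. b i - const (l i) * b m) ` {..<m}) (Suc r)"
proof -
  have "\<exists>l. (\<Sum>\<alpha>\<in>E. c \<alpha> * (\<Prod>i<m. l i ^ \<alpha> i)) \<noteq> 0"
  proof (rule exists_nonroot_multivariate[OF E(1) c(1)])
    fix \<alpha> \<beta> assume ab: "\<alpha> \<in> E" "\<beta> \<in> E" "\<forall>i<m. \<alpha> i = \<beta> i"
    have "(\<Sum>i<m. \<alpha> i) = (\<Sum>i<m. \<beta> i)" using ab by (intro sum.cong) auto
    then have "\<alpha> m = \<beta> m"
      using E(2)[OF ab(1)] E(2)[OF ab(2)] by (simp flip: lessThan_Suc_atMost)
    then show "\<alpha> = \<beta>"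
      using ab(3) E(3)[OF ab(1)] E(3)[OF ab(2)] by (metis linorder_neqE_nat ext)
  qed
  then obtain l0 where l0: "(\<Sum>\<alpha>\<in>E. c \<alpha> * (\<Prod>i<m. l0 i ^ \<alpha> i)) \<noteq> 0" by blast
  \<comment> \<open>With \<open>l m = 1\<close>, the element \<open>b m\<close> is congruent to
    \<open>l m * b m\<close> like every other \<open>b i\<close>, so all indices up to
    \<open>m\<close> are treated alike.\<close>
  define l where "l = l0(m := 1)"
  define S where "S = (\<Sum>\<alpha>\<in>E. c \<alpha> * (\<Prod>i\<le>m. l i ^ \<alpha> i))"
  have S: "S \<noteq> 0"
    using l0 by (simp add: S_def l_def flip: lessThan_Suc_atMost)
  define B where "B = (\<lambda>i. b i - const (l i) * b m) ` {..<m}"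
  let ?I = "ideal_piece P B"
  have B: "B \<subseteq> piece P 1"
    unfolding B_def using b by (auto intro!: pm.subspace_diff pm.subspace_scale subspace_piece)
  have bm: "b m \<in> piece P 1" using b by blast
  have base: "b i * h - b m * (const (l i) * h) \<in> ?I (Suc r)" if "i \<le> m" "h \<in> piece P r" for i h r
  proof (cases "i = m")
    case True
    then show ?thesis using pm.subspace_0[OF subspace_ideal_piece] by (simp add: l_def)
  next
    case False
    then have "(b i - const (l i) * b m) * h \<in> ?I (Suc r)"
      using that by (intro ideal_piece_base) (auto simp: B_def)
    then show ?thesis by (simp add: algebra_simps)
  qed
  have "(\<Prod>i\<le>m. b i ^ \<alpha> i) - const (\<Prod>i\<le>m. l i ^ \<alpha> i) * b m ^ e \<in> ?I e" if "\<alpha> \<in> E" for \<alpha>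
    using ideal_piece_cong_prod[OF P B bm, of "{..m}" b l \<alpha>] base[OF _ one_in_piece[OF P(2)]] E(2)[OF that]
    by (simp add: mult.commute)
  then have "(\<Sum>\<alpha>\<in>E. const (c \<alpha>) * ((\<Prod>i\<le>m. b i ^ \<alpha> i) - const (\<Prod>i\<le>m. l i ^ \<alpha> i) * b m ^ e)) \<in> ?I e"
    by (intro pm.subspace_sum pm.subspace_scale subspace_ideal_piece)
  also have "(\<Sum>\<alpha>\<in>E. const (c \<alpha>) * ((\<Prod>i\<le>m. b i ^ \<alpha> i) - const (\<Prod>i\<le>m. l i ^ \<alpha> i) * b m ^ e))
      = - (const S * b m ^ e)"
    unfolding S_def const_sum right_diff_distrib sum_subtractf c(2)
    by (simp add: sum_distrib_right const_mult mult.assoc)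
  finally have "const (- inverse S) * - (const S * b m ^ e) \<in> ?I e"
    by (rule pm.subspace_scale[OF subspace_ideal_piece])
  also have "const (- inverse S) * - (const S * b m ^ e) = const (inverse S * S) * b m ^ e"
    by (simp add: const_mult const_minus mult.assoc)
  finally have be: "b m ^ e \<in> ?I e" using S by simp
  \<comment> \<open>Modulo the new ideal, every element of the old ideal is a multiple of
    \<open>b m\<close>.\<close>
  have reduce: "\<exists>h\<in>piece P r. f - b m * h \<in> ?I (Suc r)"
    if "f \<in> ideal_piece P (b ` {..m}) (Suc r)" for f r
    using that unfolding ideal_piece_def[of P "b ` {..m}"]
  proof (induction rule: pm.span_induct_alt)
    case base
    show ?case
      using pm.subspace_0[OF subspace_ideal_piece] pm.subspace_0[OF subspace_piece]
      by (intro bexI[of _ 0]) auto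
  next
    case (step a x y)
    obtain i h where x: "x = b i * h" "i \<le> m" "h \<in> piece P r" using step(1) by auto
    obtain h' where h': "h' \<in> piece P r" "y - b m * h' \<in> ?I (Suc r)" using step by auto
    have "const a * (x - b m * (const (l i) * h)) + (y - b m * h') \<in> ?I (Suc r)"
      using base[OF x(2,3)] h' x by (intro pm.subspace_add pm.subspace_scale subspace_ideal_piece) auto
    then have "const a * x + y - b m * (const a * (const (l i) * h) + h') \<in> ?I (Suc r)"
      by (simp add: algebra_simps)
    moreover have "const a * (const (l i) * h) + h' \<in> piece P r"
      using x h' by (intro pm.subspace_add pm.subspace_scale subspace_piece)
    ultimately show ?case by blast
  qed
  \<comment> \<open>Factors \<open>b m\<close> are peeled off one at a time, which is possible while
    the remaining degree stays above \<open>M\<close>.\<close>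
  have iter: "\<exists>g\<in>piece P r. f - b m ^ k * g \<in> ?I (r + k)" if "f \<in> piece P (r + k)" "r \<ge> M" for r k f
    using that(1)
  proof (induction k arbitrary: f)
    case 0
    then show ?case using pm.subspace_0[OF subspace_ideal_piece] by (intro bexI[of _ f]) auto
  next
    case (Suc k)
    then have "f \<in> ideal_piece P (b ` {..m}) (Suc (r + k))" using M[of "r + k"] that(2) by auto
    then obtain h where h: "h \<in> piece P (r + k)" "f - b m * h \<in> ?I (Suc (r + k))" using reduce by blast
    obtain g where g: "g \<in> piece P r" "h - b m ^ k * g \<in> ?I (r + k)" using Suc.IH[OF h(1)] by blast
    have "(f - b m * h) + (h - b m ^ k * g) * b m \<in> ?I (r + Suc k)"
      using h(2) ideal_piece_mult[OF P(1) g(2) bm] by (intro pm.subspace_add subspace_ideal_piece) auto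
    then have "f - b m ^ Suc k * g \<in> ?I (r + Suc k)" by (simp add: algebra_simps)
    then show ?case using g by blast
  qed
  have "f \<in> ?I (Suc r)" if "r \<ge> M + e" and f: "f \<in> piece P (Suc r)" for r f
  proof -
    \<comment> \<open>This is why \<open>e\<close> is added to the bound: after \<open>e\<close>
      peelings the remaining degree is still at least \<open>M\<close>, and \<open>b m ^ e\<close>
      itself lies in the new ideal.\<close>
    have r: "Suc r = (Suc r - e) + e" "Suc r - e \<ge> M" using that by auto
    obtain g where g: "g \<in> piece P (Suc r - e)" "f - b m ^ e * g \<in> ?I (Suc r)"
      using iter[OF _ r(2), of f e] r(1) f by auto
    have "(f - b m ^ e * g) + b m ^ e * g \<in> ?I (Suc r)"
      using ideal_piece_mult[OF P(1) be g(1)] r(1) g(2)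
      by (intro pm.subspace_add subspace_ideal_piece) (auto simp: add.commute)
    then show ?thesis by simp
  qed
  then show ?thesis unfolding B_def by blast
qed

text \<open>Dimension count: the monomials of degree \<open>e\<close> in \<open>m + 1\<close>
  variables grow in number like \<open>e ^ m\<close>, while the piece of degree \<open>e\<close> has
  dimension of order at most \<open>e ^ d\<close>, and \<open>d < m\<close>.\<close>

lemma exists_algebraic_relation:
  fixes b :: "nat \<Rightarrow> ((real^'d) \<Rightarrow>\<^sub>0 'k::field)"
  assumes P: "convex P" "P \<noteq> {}" and b: "b ` {..m} \<subseteq> piece P 1"
    and N: "\<And>e. finite ((*\<^sub>R) (real e) ` P \<inter> int_points)"
      "\<And>e. card ((*\<^sub>R) (real e) ` P \<inter> int_points) \<le> K * (e + 1) ^ d"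
    and m: "d < m"
  shows "\<exists>E e c. finite E \<and> (\<forall>\<alpha>\<in>E. (\<Sum>i\<le>m. \<alpha> i) = e \<and> (\<forall>i>m. \<alpha> i = 0)) \<and>
    (\<exists>\<alpha>\<in>E. c \<alpha> \<noteq> 0) \<and> (\<Sum>\<alpha>\<in>E. const (c \<alpha>) * (\<Prod>i\<le>m. b i ^ \<alpha> i)) = 0"
proof -
  \<comment> \<open>The first \<open>m\<close> exponents range freely over \<open>0..t\<close>,
    giving \<open>(t + 1) ^ m\<close> monomials. As \<open>e + 1 \<le> m * (t + 1)\<close>, the
    dimension is at most \<open>K * m ^ d * (t + 1) ^ d = t * (t + 1) ^ d\<close>, which is less
    than \<open>(t + 1) ^ (d + 1)\<close>.\<close>
  define t where "t = K * m ^ d"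
  define e where "e = m * t"
  \<comment> \<open>The exponent of \<open>b m\<close> pads the total degree to \<open>e\<close>;
    the subtraction is exact because \<open>m\<close> exponents bounded by \<open>t\<close> sum to
    at most \<open>m * t = e\<close>.\<close>
  define ext where "ext \<beta> = (\<lambda>i. if i < m then \<beta> i else if i = m then e - sum \<beta> {..<m} else (0::nat))"
    for \<beta> :: "nat \<Rightarrow> nat"
  define E where "E = ext ` ({..<m} \<rightarrow>\<^sub>E {..t})"
  have "inj_on ext ({..<m} \<rightarrow>\<^sub>E {..t})"
  proof (rule inj_onI)
    fix \<beta> \<gamma> assume *: "\<beta> \<in> {..<m} \<rightarrow>\<^sub>E {..t}" "\<gamma> \<in> {..<m} \<rightarrow>\<^sub>E {..t}" "ext \<beta> = ext \<gamma>"
    show "\<beta> = \<gamma>"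
    proof (rule PiE_ext[OF *(1,2)])
      fix i assume "i \<in> {..<m}"
      then show "\<beta> i = \<gamma> i" using fun_cong[OF *(3), of i] by (simp add: ext_def)
    qed
  qed
  then have cardE: "card E = (t + 1) ^ m"
    by (simp add: E_def card_image card_PiE)
  have sumE: "(\<Sum>i\<le>m. \<alpha> i) = e" if "\<alpha> \<in> E" for \<alpha>
  proof -
    obtain \<beta> where \<beta>: "\<beta> \<in> {..<m} \<rightarrow>\<^sub>E {..t}" "\<alpha> = ext \<beta>" using \<open>\<alpha> \<in> E\<close> by (auto simp: E_def)
    have "sum \<beta> {..<m} \<le> (\<Sum>i<m. t)" using \<beta> by (intro sum_mono) auto
    then have "sum \<beta> {..<m} \<le> e" by (simp add: e_def)
    then show ?thesis by (simp add: \<beta> ext_def flip: lessThan_Suc_atMost)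
  qed
  have finE: "finite E" by (simp add: E_def finite_PiE)
  let ?T = "(\<lambda>z. Poly_Mapping.single z (1::'k)) ` ((*\<^sub>R) (real e) ` P \<inter> int_points)"
  have "(\<Prod>i\<in>I. b i ^ \<alpha> i) \<in> piece P (sum \<alpha> I)" if "finite I" "I \<subseteq> {..m}" for I \<alpha>
    using that
  proof (induction I)
    case empty
    then show ?case using one_in_piece[OF P(2)] by simp
  next
    case (insert j I)
    then show ?case
      using mult_in_piece[OF P(1) power_in_piece[OF P, of "b j" 1 "\<alpha> j"], of "\<Prod>i\<in>I. b i ^ \<alpha> i"] b by auto
  qed
  from this[of "{..m}"] have sub: "(\<lambda>\<alpha>. \<Prod>i\<le>m. b i ^ \<alpha> i) ` E \<subseteq> pm.span ?T"
    unfolding piece_eq_span[symmetric] using sumE by force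
  have "card ?T \<le> card ((*\<^sub>R) (real e) ` P \<inter> int_points)" by (rule card_image_le[OF N(1)])
  also have "\<dots> \<le> K * (e + 1) ^ d" by (rule N(2))
  also have "\<dots> \<le> K * (m * (t + 1)) ^ d"
    using m by (intro mult_left_mono power_mono) (auto simp: e_def)
  also have "\<dots> = t * (t + 1) ^ d" unfolding power_mult_distrib t_def by simp
  also have "\<dots> < (t + 1) ^ Suc d" by simp
  also have "\<dots> \<le> (t + 1) ^ m" using m by (intro power_increasing) auto
  finally have "card ?T < card E" by (simp add: cardE)
  from pm.linear_relation_of_card[OF finE _ sub this] N(1)
  obtain c where "\<exists>\<alpha>\<in>E. c \<alpha> \<noteq> 0" "(\<Sum>\<alpha>\<in>E. const (c \<alpha>) * (\<Prod>i\<le>m. b i ^ \<alpha> i)) = 0" by auto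
  moreover have "\<forall>\<alpha>\<in>E. (\<Sum>i\<le>m. \<alpha> i) = e \<and> (\<forall>i>m. \<alpha> i = 0)"
    using sumE by (auto simp: E_def ext_def)
  ultimately show ?thesis using finE by blast
qed

lemma sum_lattice_points_mem:
  fixes P :: "(real^'d) set"
  assumes "convex P" "P \<noteq> {}" "\<And>i. i \<in> {1..c} \<Longrightarrow> x i \<in> P \<inter> int_points"
  shows "(\<Sum>i = 1..c. x i) \<in> (*\<^sub>R) (real c) ` P \<inter> int_points"
  using assms(3)
proof (induction c)
  case 0
  then show ?case using assms(2) int_points_0 by auto
next
  case (Suc c)
  then have "(\<Sum>i = 1..c. x i) \<in> (*\<^sub>R) (real c) ` P \<inter> int_points" by auto
  then show ?case
    using Suc.prems[of "Suc c"] scaled_convex_add[OF assms(1), of "\<Sum>i = 1..c. x i" c "x (Suc c)" 1]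
      int_points_add[of "\<Sum>i = 1..c. x i" "x (Suc c)"] by (auto simp: add.commute)
qed

text \<open>The form in which integral closedness enters: one degree 1 factor can be split off any
  monomial of positive degree. The remaining summands stay in the dilate by convexity.\<close>

lemma integrally_closed_decompose:
  fixes P :: "(real^'d) set"
  assumes "integrally_closed P" "convex P" "P \<noteq> {}" "z \<in> (*\<^sub>R) (real (Suc c)) ` P \<inter> int_points"
  shows "\<exists>a\<in>P \<inter> int_points. \<exists>y\<in>(*\<^sub>R) (real c) ` P \<inter> int_points. z = a + y"
proof -
  obtain x where x: "\<And>i. i \<in> {1..Suc c} \<Longrightarrow> x i \<in> P \<inter> int_points" "(\<Sum>i = 1..Suc c. x i) = z"
    using assms(1,4) unfolding integrally_closed_def by (metis zero_less_Suc)
  have "(\<Sum>i = 1..c. x i) \<in> (*\<^sub>R) (real c) ` P \<inter> int_points"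
    by (rule sum_lattice_points_mem[OF assms(2,3)]) (use x in auto)
  then show ?thesis using x(1)[of "Suc c"] x(2) by (force simp: add.commute)
qed

lemma exists_noether_normalization:
  fixes P :: "(real^'d) set"
  assumes P: "convex P" "P \<noteq> {}" "integrally_closed P"
    and N: "\<And>e. finite ((*\<^sub>R) (real e) ` P \<inter> int_points)"
      "\<And>e. card ((*\<^sub>R) (real e) ` P \<inter> int_points) \<le> K * (e + 1) ^ d"
    and n: "n = card (P \<inter> int_points)" "d < n"
  shows "\<exists>(b :: nat \<Rightarrow> (real^'d) \<Rightarrow>\<^sub>0 'k::alg_closed_field) M. b ` {..<n} \<subseteq> piece P 1 \<and>
    piece P 1 \<subseteq> pm.span (b ` {..<n}) \<and>
    (\<forall>r\<ge>M. piece P (Suc r) \<subseteq> ideal_piece P (b ` {..d}) (Suc r))"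
proof -
  define Q where "Q m \<longleftrightarrow> (\<exists>(b :: nat \<Rightarrow> (real^'d) \<Rightarrow>\<^sub>0 'k) M. b ` {..<n} \<subseteq> piece P 1 \<and>
    piece P 1 \<subseteq> pm.span (b ` {..<n}) \<and>
    (\<forall>r\<ge>M. piece P (Suc r) \<subseteq> ideal_piece P (b ` {..<m}) (Suc r)))" for m
  have "Q (Suc d)"
  proof (rule inc_induct[of "Suc d" n])
    show "Suc d \<le> n" using n by simp
  next
    have "finite (P \<inter> int_points)" using N(1)[of 1] by simp
    then obtain z where z: "bij_betw z {..<n} (P \<inter> int_points)"
      using n(1) by (metis atLeast0LessThan ex_bij_betw_nat_finite)
    define b :: "nat \<Rightarrow> (real^'d) \<Rightarrow>\<^sub>0 'k" where "b i = Poly_Mapping.single (z i) 1" for i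
    have b: "b ` {..<n} = (\<lambda>z. Poly_Mapping.single z 1) ` (P \<inter> int_points)"
      unfolding b_def bij_betw_imp_surj_on[OF z, symmetric] image_image ..
    \<comment> \<open>Start of the induction: splitting off a lattice point of \<open>P\<close> puts
      every monomial of positive degree into the ideal generated by all of degree 1.\<close>
    have "piece P (Suc r) \<subseteq> ideal_piece P (b ` {..<n}) (Suc r)" for r
      unfolding piece_eq_span[of P "Suc r"]
    proof (rule pm.span_minimal[OF _ subspace_ideal_piece], safe)
      fix w assume "w \<in> P" "real (Suc r) *\<^sub>R w \<in> int_points"
      then obtain a y where ay: "a \<in> P \<inter> int_points" "y \<in> (*\<^sub>R) (real r) ` P \<inter> int_points"
        "real (Suc r) *\<^sub>R w = a + y"
        using integrally_closed_decompose[OF P(3,1,2), of "real (Suc r) *\<^sub>R w" r] by blast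
      have "Poly_Mapping.single a 1 * Poly_Mapping.single y 1 \<in> ideal_piece P (b ` {..<n}) (Suc r)"
        using ay by (intro ideal_piece_base single_in_piece) (auto simp: b)
      then show "Poly_Mapping.single (real (Suc r) *\<^sub>R w) 1 \<in> ideal_piece P (b ` {..<n}) (Suc r)"
        unfolding ay(3) mult_single by simp
    qed
    moreover have "b ` {..<n} \<subseteq> piece P 1" unfolding b by (auto simp: piece_def)
    moreover have "piece P 1 \<subseteq> pm.span (b ` {..<n})" unfolding b piece_eq_span by simp
    ultimately show "Q n" unfolding Q_def by blast
  next
    fix m assume m: "Suc d \<le> m" "m < n" "Q (Suc m)"
    then obtain b :: "nat \<Rightarrow> (real^'d) \<Rightarrow>\<^sub>0 'k" and M where b: "b ` {..<n} \<subseteq> piece P 1"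
      "piece P 1 \<subseteq> pm.span (b ` {..<n})"
      "\<And>r. r \<ge> M \<Longrightarrow> piece P (Suc r) \<subseteq> ideal_piece P (b ` {..m}) (Suc r)"
      unfolding Q_def lessThan_Suc_atMost by blast
    have bm: "b i \<in> piece P 1" if "i \<le> m" for i using b(1) that m by auto
    then have bm': "b ` {..m} \<subseteq> piece P 1" by blast
    obtain E e c where "finite E" "\<forall>\<alpha>\<in>E. (\<Sum>i\<le>m. \<alpha> i) = e \<and> (\<forall>i>m. \<alpha> i = 0)"
      "\<exists>\<alpha>\<in>E. c \<alpha> \<noteq> 0" "(\<Sum>\<alpha>\<in>E. const (c \<alpha>) * (\<Prod>i\<le>m. b i ^ \<alpha> i)) = 0"
      using exists_algebraic_relation[OF P(1,2) bm' N Suc_le_lessD[OF m(1)]]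
      by (elim exE conjE) (rule that)
    then obtain l where l: "\<forall>r\<ge>M + e. piece P (Suc r) \<subseteq>
        ideal_piece P ((\<lambda>i. b i - const (l i) * b m) ` {..<m}) (Suc r)"
      using noether_normalization_step[OF P(1,2) bm _ _ _ _ _ b(3), of E e c] by blast
    \<comment> \<open>A triangular change of generators: \<open>b' m = b m\<close>, so each old
      \<open>b i\<close> is recovered and the span does not shrink.\<close>
    define b' where "b' i = (if i < m then b i - const (l i) * b m else b i)" for i
    have "b' ` {..<n} \<subseteq> piece P 1"
      unfolding b'_def using b(1) m by (auto intro!: pm.subspace_diff pm.subspace_scale subspace_piece)
    moreover have "piece P 1 \<subseteq> pm.span (b' ` {..<n})"
    proof -
      have "b i \<in> pm.span (b' ` {..<n})" if "i < n" for i
      proof (cases "i < m")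
        case True
        have "b' i + const (l i) * b' m \<in> pm.span (b' ` {..<n})"
          using that m by (intro pm.span_add pm.span_scale pm.span_base) auto
        then show ?thesis using True by (simp add: b'_def)
      next
        case False
        then have "b i = b' i" by (simp add: b'_def)
        then show ?thesis using that by (auto intro: pm.span_base)
      qed
      then have "pm.span (b ` {..<n}) \<subseteq> pm.span (b' ` {..<n})"
        by (intro pm.span_minimal pm.subspace_span) auto
      then show ?thesis using b(2) by blast
    qed
    moreover have "(\<lambda>i. b i - const (l i) * b m) ` {..<m} = b' ` {..<m}"
      by (rule image_cong) (auto simp: b'_def)
    note l[unfolded this]
    ultimately show "Q m"
      unfolding Q_def by (intro exI[of _ b'] exI[of _ "M + e"] conjI)
  qed
  then show ?thesis unfolding Q_def lessThan_Suc_atMost .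
qed

section \<open>Ideals generated by powers: the pigeonhole principle\<close>

lemma mult_span_subset:
  fixes S :: "('a::comm_monoid_add \<Rightarrow>\<^sub>0 'k::field) set"
  assumes "f \<in> pm.span S" "pm.subspace T" "\<And>x. x \<in> S \<Longrightarrow> y * x \<in> T"
  shows "y * f \<in> T"
  using assms(1)
proof (induction rule: pm.span_induct_alt)
  case base
  then show ?case using pm.subspace_0[OF assms(2)] by simp
next
  case (step c x f)
  then have "const c * (y * x) + y * f \<in> T"
    using assms(3) by (intro pm.subspace_add pm.subspace_scale assms(2)) auto
  then show ?case by (simp add: algebra_simps)
qed

text \<open>The degree \<open>c\<close> part of the ideal generated by the powers
  \<open>b i ^ \<beta> i\<close>. The exponents may differ, although they are all equal in the
  application, because the induction below lowers them one at a time.\<close>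

definition power_ideal_piece ::
    "(real^'d) set \<Rightarrow> (nat \<Rightarrow> (real^'d) \<Rightarrow>\<^sub>0 'k) \<Rightarrow> (nat \<Rightarrow> nat) \<Rightarrow> nat \<Rightarrow> nat \<Rightarrow> ((real^'d) \<Rightarrow>\<^sub>0 'k::field) set" where
  "power_ideal_piece P b \<beta> d c = pm.span {b i ^ \<beta> i * h | i h j. i \<le> d \<and> h \<in> piece P j \<and> c = \<beta> i + j}"

lemma power_ideal_piece_base:
  "i \<le> d \<Longrightarrow> h \<in> piece P j \<Longrightarrow> b i ^ \<beta> i * h \<in> power_ideal_piece P b \<beta> d (\<beta> i + j)"
  unfolding power_ideal_piece_def by (rule pm.span_base) auto

text \<open>Above degree \<open>M\<close> an element is a sum of terms \<open>b i * h\<close>. By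
  induction \<open>h\<close> lies in the ideal with \<open>\<beta> i\<close> lowered by one.
  Multiplying by \<open>b i\<close> completes the power at index \<open>i\<close>, and at any other
  index \<open>b i\<close> joins the cofactor. If some exponent is 0, the ideal is
  everything.\<close>

lemma piece_subset_power_ideal_piece:
  fixes b :: "nat \<Rightarrow> (real^'d) \<Rightarrow>\<^sub>0 'k::field"
  assumes P: "convex P" and b: "\<And>i. i \<le> d \<Longrightarrow> b i \<in> piece P 1"
    and M: "\<And>r. r \<ge> M \<Longrightarrow> piece P (Suc r) \<subseteq> ideal_piece P (b ` {..d}) (Suc r)"
    and c: "c \<ge> M + (\<Sum>i\<le>d. \<beta> i)"
  shows "piece P c \<subseteq> power_ideal_piece P b \<beta> d c"
  using c
proof (induction "\<Sum>i\<le>d. \<beta> i" arbitrary: \<beta> c rule: less_induct)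
  case less
  show ?case
  proof (cases "\<exists>i\<le>d. \<beta> i = 0")
    case True
    then obtain i where i: "i \<le> d" "\<beta> i = 0" by auto
    show ?thesis
    proof
      fix f :: "(real^'d) \<Rightarrow>\<^sub>0 'k" assume "f \<in> piece P c"
      then show "f \<in> power_ideal_piece P b \<beta> d c"
        using power_ideal_piece_base[OF i(1), of f P c b \<beta>] i by simp
    qed
  next
    case False
    then have pos: "\<beta> i > 0" if "i \<le> d" for i using that by auto
    have sum_pos: "(\<Sum>i\<le>d. \<beta> i) > 0"
      using pos[of 0] by (metis atMost_iff bot_nat_0.extremum finite_atMost less_le_trans member_le_sum zero_le)
    \<comment> \<open>As the exponent sum is positive, \<open>c\<close> exceeds \<open>M\<close>, so
      its predecessor is still in the range of the hypothesis on \<open>M\<close>.\<close>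
    then obtain r where r: "c = Suc r" "r \<ge> M" using less.prems by (cases c) auto
    have "ideal_piece P (b ` {..d}) (Suc r) \<subseteq> power_ideal_piece P b \<beta> d c"
      unfolding ideal_piece_def
    proof (rule pm.span_minimal, intro subsetI)
      show "pm.subspace (power_ideal_piece P b \<beta> d c)"
        unfolding power_ideal_piece_def by (rule pm.subspace_span)
      fix f :: "(real^'d) \<Rightarrow>\<^sub>0 'k"
      assume "f \<in> {b' * h |b' h j. b' \<in> b ` {..d} \<and> h \<in> piece P j \<and> Suc r = Suc j}"
      then obtain i h where f: "f = b i * h" and i: "i \<in> {..d}" and h: "h \<in> piece P r" by auto
      define \<beta>' where "\<beta>' = \<beta>(i := \<beta> i - 1)"
      have "(\<Sum>j\<le>d. \<beta> j) = \<beta> i + sum \<beta> ({..d} - {i})"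
        using i by (simp add: sum.remove)
      moreover have "(\<Sum>j\<le>d. \<beta>' j) = (\<beta> i - 1) + sum \<beta>' ({..d} - {i})"
        using i by (simp add: sum.remove \<beta>'_def)
      moreover have "sum \<beta>' ({..d} - {i}) = sum \<beta> ({..d} - {i})"
        by (rule sum.cong) (auto simp: \<beta>'_def)
      ultimately have s: "(\<Sum>j\<le>d. \<beta> j) = Suc (\<Sum>j\<le>d. \<beta>' j)"
        using pos[of i] i by simp
      have "h \<in> power_ideal_piece P b \<beta>' d r"
        using less.hyps[of \<beta>' r] s less.prems r h by auto
      then show "f \<in> power_ideal_piece P b \<beta> d c"
        unfolding f power_ideal_piece_def[of P b \<beta>']
      proof (rule mult_span_subset)
        show "pm.subspace (power_ideal_piece P b \<beta> d c)"
          unfolding power_ideal_piece_def by (rule pm.subspace_span)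
        fix x :: "(real^'d) \<Rightarrow>\<^sub>0 'k" assume "x \<in> {b i ^ \<beta>' i * h |i h j. i \<le> d \<and> h \<in> piece P j \<and> r = \<beta>' i + j}"
        then obtain i' h' j' where x: "x = b i' ^ \<beta>' i' * h'" "i' \<le> d" "h' \<in> piece P j'" "r = \<beta>' i' + j'"
          by blast
        show "b i * x \<in> power_ideal_piece P b \<beta> d c"
        proof (cases "i' = i")
          case True
          then have "b i * x = b i ^ \<beta> i * h'"
            using pos[OF x(2)] by (simp add: x(1) \<beta>'_def mult.assoc[symmetric] flip: power_Suc)
          moreover have "c = \<beta> i + j'" using True pos[OF x(2)] by (simp add: r x(4) \<beta>'_def)
          ultimately show ?thesis using power_ideal_piece_base[of i d h' P j' b \<beta>] i x by simp
        next
          case False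
          then have "b i * x = b i' ^ \<beta> i' * (b i * h')"
            by (simp add: x(1) \<beta>'_def mult.left_commute)
          moreover have "c = \<beta> i' + Suc j'" using False by (simp add: r x(4) \<beta>'_def)
          moreover have "b i * h' \<in> piece P (Suc j')"
            using mult_in_piece[OF P b x(3), of i] i by simp
          ultimately show ?thesis using power_ideal_piece_base[OF x(2), of "b i * h'" P "Suc j'" b \<beta>] by simp
        qed
      qed
    qed
    then show ?thesis using M[OF r(2)] r(1) by blast
  qed
qed

section \<open>Frobenius roots in characteristic 2\<close>

lemma add_power_two_power:
  fixes x y :: "'a::comm_semiring_1"
  assumes "(2::'a) = 0"
  shows "(x + y) ^ 2 ^ k = x ^ 2 ^ k + y ^ 2 ^ k"
proof (induction k)
  case (Suc k)
  have "(x + y) ^ 2 ^ Suc k = ((x + y) ^ 2 ^ k)\<^sup>2" by (simp only: power_Suc2 power_mult)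
  also have "\<dots> = (x ^ 2 ^ k)\<^sup>2 + (y ^ 2 ^ k)\<^sup>2" by (simp add: Suc power2_sum assms)
  finally show ?case by (simp only: power_Suc2 power_mult)
qed simp

lemma sum_power_two_power:
  fixes f :: "'i \<Rightarrow> 'a::comm_semiring_1"
  assumes "(2::'a) = 0"
  shows "(\<Sum>i\<in>I. f i) ^ 2 ^ k = (\<Sum>i\<in>I. f i ^ 2 ^ k)"
  by (induction I rule: infinite_finite_induct) (auto simp: add_power_two_power[OF assms] zero_power)

text \<open>Over an algebraically closed field of characteristic 2 the map being inverted is
  bijective, so the root is unique, additive and multiplicative.\<close>

definition frobenius_root :: "nat \<Rightarrow> 'k::field \<Rightarrow> 'k" where
  "frobenius_root k = inv_into UNIV (\<lambda>x. x ^ 2 ^ k)"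

lemma inj_frobenius:
  assumes "(2::'k::field) = 0"
  shows "inj (\<lambda>x::'k. x ^ 2 ^ k)"
proof (rule injI)
  fix x y :: 'k assume "x ^ 2 ^ k = y ^ 2 ^ k"
  moreover have "(x - y) ^ 2 ^ k + y ^ 2 ^ k = x ^ 2 ^ k"
    using add_power_two_power[OF assms, of "x - y" y k] by simp
  ultimately have "(x - y) ^ 2 ^ k = 0" by simp
  then show "x = y" by simp
qed

lemma frobenius_root_power:
  assumes "(2::'k::field) = 0"
  shows "frobenius_root k ((x::'k) ^ 2 ^ k) = x"
  unfolding frobenius_root_def using inv_f_f[OF inj_frobenius[OF assms]] .

lemma power_frobenius_root: "frobenius_root k (x::'k::alg_closed_field) ^ 2 ^ k = x"
proof -
  obtain y where "y ^ 2 ^ k = x" using nth_root_exists[of "2 ^ k" x] by auto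
  then have "x \<in> range (\<lambda>x. x ^ 2 ^ k)" by auto
  then show ?thesis unfolding frobenius_root_def by (rule f_inv_into_f)
qed

lemma frobenius_root_add:
  assumes "(2::'k::alg_closed_field) = 0"
  shows "frobenius_root k (x + y :: 'k) = frobenius_root k x + frobenius_root k y"
  using frobenius_root_power[OF assms, of k "frobenius_root k x + frobenius_root k y"]
  by (simp add: add_power_two_power[OF assms] power_frobenius_root)

lemma frobenius_root_mult:
  assumes "(2::'k::alg_closed_field) = 0"
  shows "frobenius_root k (x * y :: 'k) = frobenius_root k x * frobenius_root k y"
  using frobenius_root_power[OF assms, of k "frobenius_root k x * frobenius_root k y"]
  by (simp add: power_mult_distrib power_frobenius_root)

lemma frobenius_root_0: "(2::'k::field) = 0 \<Longrightarrow> frobenius_root k (0::'k) = 0"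
  using frobenius_root_power[of k "0::'k"] by (simp add: zero_power)

lemma frobenius_root_1: "(2::'k::field) = 0 \<Longrightarrow> frobenius_root k (1::'k) = 1"
  using frobenius_root_power[of k "1::'k"] by simp

lemma frobenius_root_sum:
  fixes f :: "'i \<Rightarrow> 'k::alg_closed_field"
  assumes "(2::'k) = 0"
  shows "frobenius_root k (\<Sum>i\<in>I. f i) = (\<Sum>i\<in>I. frobenius_root k (f i))"
  by (induction I rule: infinite_finite_induct)
    (auto simp: frobenius_root_0[OF assms] frobenius_root_add[OF assms])

lemma lookup_single_mult:
  fixes h :: "'a::ab_group_add \<Rightarrow>\<^sub>0 'k::comm_semiring_1"
  shows "Poly_Mapping.lookup (Poly_Mapping.single a t * h) z = t * Poly_Mapping.lookup h (z - a)"
proof -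
  have "Poly_Mapping.single a t * h =
      (\<Sum>w\<in>Poly_Mapping.keys h. Poly_Mapping.single (a + w) (t * Poly_Mapping.lookup h w))"
    by (subst poly_mapping_eq_sum_single[of h]) (simp only: sum_distrib_left mult_single)
  then have "Poly_Mapping.lookup (Poly_Mapping.single a t * h) z =
      (\<Sum>w\<in>Poly_Mapping.keys h. if w = z - a then t * Poly_Mapping.lookup h w else 0)"
    by (auto simp: lookup_sum lookup_single when_def algebra_simps intro!: sum.cong)
  then show ?thesis by (simp add: in_keys_iff)
qed

text \<open>
  With \<open>q = 2 ^ k\<close>, this sends the monomial with exponent \<open>q z + u\<close> to the one with exponent \<open>z\<close>,
  for lattice points \<open>z\<close>, takes \<open>q\<close>-th roots of coefficients, and kills all other monomials.
\<close>
definition frobenius_trace ::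
    "nat \<Rightarrow> real^'d \<Rightarrow> ((real^'d) \<Rightarrow>\<^sub>0 'k) \<Rightarrow> ((real^'d) \<Rightarrow>\<^sub>0 'k::field)" where
  "frobenius_trace k u f = Poly_Mapping.Abs_poly_mapping (\<lambda>z.
     if z \<in> int_points then frobenius_root k (Poly_Mapping.lookup f (2 ^ k *\<^sub>R z + u)) else 0)"

lemma lookup_frobenius_trace:
  fixes f :: "(real^'d) \<Rightarrow>\<^sub>0 'k::field"
  assumes "(2::'k) = 0"
  shows "Poly_Mapping.lookup (frobenius_trace k u f) z =
    (if z \<in> int_points then frobenius_root k (Poly_Mapping.lookup f (2 ^ k *\<^sub>R z + u)) else 0)"
proof -
  \<comment> \<open>The support is finite because \<open>z\<close> is recovered from the exponent
    \<open>2 ^ k *\<^sub>R z + u\<close>.\<close>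
  have "{z. (if z \<in> int_points then frobenius_root k (Poly_Mapping.lookup f (2 ^ k *\<^sub>R z + u)) else 0) \<noteq> 0}
      \<subseteq> (\<lambda>w. (1 / 2 ^ k) *\<^sub>R (w - u)) ` Poly_Mapping.keys f"
  proof
    fix z assume "z \<in> {z. (if z \<in> int_points
        then frobenius_root k (Poly_Mapping.lookup f (2 ^ k *\<^sub>R z + u)) else 0) \<noteq> 0}"
    then have "2 ^ k *\<^sub>R z + u \<in> Poly_Mapping.keys f"
      using frobenius_root_0[OF assms] by (auto simp: in_keys_iff split: if_splits)
    moreover have "z = (1 / 2 ^ k) *\<^sub>R ((2 ^ k *\<^sub>R z + u) - u)" by simp
    ultimately show "z \<in> (\<lambda>w. (1 / 2 ^ k) *\<^sub>R (w - u)) ` Poly_Mapping.keys f" by blast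
  qed
  from finite_subset[OF this] show ?thesis
    unfolding frobenius_trace_def by (subst lookup_Abs_poly_mapping) auto
qed

lemma frobenius_trace_add:
  fixes f g :: "(real^'d) \<Rightarrow>\<^sub>0 'k::alg_closed_field"
  assumes "(2::'k) = 0"
  shows "frobenius_trace k u (f + g) = frobenius_trace k u f + frobenius_trace k u g"
  by (rule poly_mapping_eqI)
    (simp add: lookup_frobenius_trace[OF assms] lookup_add frobenius_root_add[OF assms])

lemma frobenius_trace_scale:
  fixes f :: "(real^'d) \<Rightarrow>\<^sub>0 'k::alg_closed_field"
  assumes "(2::'k) = 0"
  shows "frobenius_trace k u (const a * f) = const (frobenius_root k a) * frobenius_trace k u f"
  by (rule poly_mapping_eqI)
    (simp add: lookup_frobenius_trace[OF assms] lookup_const_mult frobenius_root_mult[OF assms])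

text \<open>In characteristic 2 the power \<open>b ^ 2 ^ k\<close> has no cross terms: its exponents
  are those of \<open>b\<close> scaled by \<open>2 ^ k\<close>. A shift by
  \<open>2 ^ k *\<^sub>R a\<close> before the trace is a shift by \<open>a\<close> after it. As the
  exponents \<open>a\<close> of \<open>b\<close> are lattice points, \<open>z\<close> and
  \<open>z - a\<close> are lattice points together, so both sides vanish off the lattice.\<close>

lemma frobenius_trace_power_mult:
  fixes b h :: "(real^'d) \<Rightarrow>\<^sub>0 'k::alg_closed_field"
  assumes two: "(2::'k) = 0" and b: "Poly_Mapping.keys b \<subseteq> int_points"
  shows "frobenius_trace k u (b ^ 2 ^ k * h) = b * frobenius_trace k u h"
proof (rule poly_mapping_eqI)
  fix z
  let ?K = "Poly_Mapping.keys b"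
  let ?t = "Poly_Mapping.lookup b"
  have two': "(2 :: (real^'d) \<Rightarrow>\<^sub>0 'k) = 0"
    by (rule poly_mapping_eqI) (simp add: lookup_numeral two when_def)
  have bq: "b ^ 2 ^ k = (\<Sum>a\<in>?K. Poly_Mapping.single (2 ^ k *\<^sub>R a) (?t a ^ 2 ^ k))"
  proof -
    have "Poly_Mapping.single a t ^ n = Poly_Mapping.single (real n *\<^sub>R a) (t ^ n)"
      for a :: "real^'d" and t :: 'k and n
      by (induction n) (auto simp: mult_single scaleR_left_distrib)
    from this[of _ _ "2 ^ k"] show ?thesis
      by (subst poly_mapping_eq_sum_single[of b]) (simp add: sum_power_two_power[OF two'])
  qed
  have L: "Poly_Mapping.lookup (b ^ 2 ^ k * h) w
      = (\<Sum>a\<in>?K. ?t a ^ 2 ^ k * Poly_Mapping.lookup h (w - 2 ^ k *\<^sub>R a))" for w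
    by (simp add: bq sum_distrib_right lookup_sum lookup_single_mult)
  have R: "Poly_Mapping.lookup (b * g) w = (\<Sum>a\<in>?K. ?t a * Poly_Mapping.lookup g (w - a))" for g w
    by (subst poly_mapping_eq_sum_single[of b]) (simp add: sum_distrib_right lookup_sum lookup_single_mult)
  show "Poly_Mapping.lookup (frobenius_trace k u (b ^ 2 ^ k * h)) z =
      Poly_Mapping.lookup (b * frobenius_trace k u h) z"
  proof (cases "z \<in> int_points")
    case True
    then have za: "z - a \<in> int_points" if "a \<in> ?K" for a using b that int_points_diff by blast
    have shift: "2 ^ k *\<^sub>R z + u - 2 ^ k *\<^sub>R a = 2 ^ k *\<^sub>R (z - a) + u" for a
      by (simp add: algebra_simps)
    have "Poly_Mapping.lookup (frobenius_trace k u (b ^ 2 ^ k * h)) z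
        = (\<Sum>a\<in>?K. ?t a * frobenius_root k (Poly_Mapping.lookup h (2 ^ k *\<^sub>R (z - a) + u)))"
      using True by (simp only: lookup_frobenius_trace[OF two] if_True L frobenius_root_sum[OF two]
        frobenius_root_mult[OF two] frobenius_root_power[OF two] shift)
    also have "\<dots> = Poly_Mapping.lookup (b * frobenius_trace k u h) z"
      unfolding R using za by (intro sum.cong) (auto simp: lookup_frobenius_trace[OF two])
    finally show ?thesis .
  next
    case False
    then have "z - a \<notin> int_points" if "a \<in> ?K" for a
      using b that int_points_add[of "z - a" a] by auto
    then show ?thesis
      using False by (simp add: lookup_frobenius_trace[OF two] R)
  qed
qed

section \<open>The tight closure argument\<close>

lemma bounded_int_points:
  fixes S :: "(real^'d) set"
  assumes "S \<subseteq> int_points" "\<And>x i. x \<in> S \<Longrightarrow> \<bar>x $ i\<bar> \<le> real B"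
  shows "finite S" "card S \<le> (2 * B + 1) ^ CARD('d)"
proof -
  define F where "F = (\<lambda>(x::real^'d) i. \<lfloor>x $ i\<rfloor>)"
  have inj: "inj_on F S"
  proof (rule inj_onI)
    fix x y assume *: "x \<in> S" "y \<in> S" "F x = F y"
    show "x = y"
    proof (rule vec_eq_iff[THEN iffD2], rule allI)
      fix i
      have "x $ i = of_int \<lfloor>x $ i\<rfloor>" "y $ i = of_int \<lfloor>y $ i\<rfloor>"
        using * assms(1) by (auto simp: int_points_def Ints_def)
      then show "x $ i = y $ i" using fun_cong[OF *(3), of i] by (simp add: F_def)
    qed
  qed
  have sub: "F ` S \<subseteq> (UNIV \<rightarrow>\<^sub>E {- int B..int B})"
  proof safe
    fix x i assume "x \<in> S"
    then have "- real B \<le> x $ i" "x $ i \<le> real B" using assms(2)[of x i] by auto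
    then show "F x i \<in> {- int B..int B}"
      by (auto simp: F_def le_floor_iff floor_le_iff)
  qed auto
  have fin: "finite ((UNIV :: 'd set) \<rightarrow>\<^sub>E {- int B..int B})" by (intro finite_PiE) auto
  show "finite S" using finite_subset[OF sub fin] inj by (simp add: finite_image_iff)
  have "card S = card (F ` S)" using inj by (simp add: card_image)
  also have "\<dots> \<le> card ((UNIV :: 'd set) \<rightarrow>\<^sub>E {- int B..int B})" by (rule card_mono[OF fin sub])
  also have "\<dots> = (2 * B + 1) ^ CARD('d)"
  proof -
    have "card {- int B..int B} = 2 * B + 1" by simp
    then show ?thesis by (simp only: card_PiE finite prod_constant)
  qed
  finally show "card S \<le> (2 * B + 1) ^ CARD('d)" .
qed

text \<open>If \<open>q z + u = (q c + M) p\<close> with \<open>p\<close> in \<open>P\<close>, then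
  \<open>z - c p = (M p - u) / q\<close>, so \<open>z\<close> is within \<open>W / q\<close> of
  \<open>c P\<close>. This confines \<open>z\<close> to a finite set of lattice points. Each of them
  outside the closed set \<open>c P\<close> has positive distance from it and is excluded for large
  \<open>q\<close>; finiteness makes the threshold uniform.\<close>

lemma eventually_lattice_point_descends:
  fixes P :: "(real^'d) set"
  assumes P: "compact P"
  shows "\<forall>\<^sub>F q in sequentially. \<forall>z\<in>int_points.
    real q *\<^sub>R z + u \<in> (*\<^sub>R) (real (q * c + M)) ` P \<longrightarrow> z \<in> (*\<^sub>R) (real c) ` P"
proof -
  obtain R where R: "R > 0" "\<And>p. p \<in> P \<Longrightarrow> norm p \<le> R"
    using compact_imp_bounded[OF P] bounded_pos by blast
  define W where "W = real M * R + norm u"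
  have W: "W \<ge> 0" using R by (simp add: W_def)
  have near: "norm (z - real c *\<^sub>R p) \<le> W / real q"
    if "q > 0" "p \<in> P" "real q *\<^sub>R z + u = real (q * c + M) *\<^sub>R p" for q z p
  proof -
    have "real q *\<^sub>R (z - real c *\<^sub>R p) = real M *\<^sub>R p - u"
      using that(3) by (simp add: algebra_simps)
    then have "real q * norm (z - real c *\<^sub>R p) = norm (real M *\<^sub>R p - u)"
      by (metis abs_of_nat norm_scaleR)
    also have "\<dots> \<le> norm (real M *\<^sub>R p) + norm u" by (rule norm_triangle_ineq4)
    also have "\<dots> \<le> W" using R(2)[OF that(2)] by (simp add: W_def mult_left_mono)
    finally show ?thesis using that(1) by (simp add: field_simps)
  qed
  \<comment> \<open>Every candidate \<open>z\<close> for any \<open>q \<ge> 1\<close> lies here,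
    since \<open>W / q \<le> W\<close>.\<close>
  define F where "F = {z \<in> int_points :: (real^'d) set. norm z \<le> real c * R + W}"
  obtain N :: nat where N: "real c * R + W \<le> real N" using real_arch_simple by blast
  have "finite F"
  proof (rule bounded_int_points(1)[of _ N])
    show "\<bar>vec_nth x i\<bar> \<le> real N" if "x \<in> F" for x i
      using that component_le_norm_cart[of x i] N by (auto simp: F_def)
  qed (auto simp: F_def)
  moreover have "\<forall>\<^sub>F q in sequentially.
      real q *\<^sub>R z + u \<in> (*\<^sub>R) (real (q * c + M)) ` P \<longrightarrow> z \<in> (*\<^sub>R) (real c) ` P" for z
  proof (cases "z \<in> (*\<^sub>R) (real c) ` P")
    case False
    have "closed ((*\<^sub>R) (real c) ` P)" using P by (intro compact_imp_closed compact_scaling)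
    then obtain \<delta> where \<delta>: "\<delta> > 0" "\<And>y. y \<in> (*\<^sub>R) (real c) ` P \<Longrightarrow> \<delta> \<le> dist z y"
      using False separate_point_closed by metis
    have "(\<lambda>q. W / real q) \<longlonglongrightarrow> 0" by real_asymp
    then have "\<forall>\<^sub>F q in sequentially. W / real q < \<delta>" using \<delta>(1) by (rule order_tendstoD)
    then show ?thesis
      using eventually_gt_at_top[of 0]
    proof eventually_elim
      case (elim q)
      show ?case
      proof safe
        fix p assume "p \<in> P" "real q *\<^sub>R z + u = real (q * c + M) *\<^sub>R p"
        then show "z \<in> (*\<^sub>R) (real c) ` P"
          using near[of q p z] \<delta>(2)[of "real c *\<^sub>R p"] elim by (auto simp: dist_norm)
      qed
    qed
  qed simp
  ultimately have "\<forall>\<^sub>F q in sequentially. \<forall>z\<in>F.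
      real q *\<^sub>R z + u \<in> (*\<^sub>R) (real (q * c + M)) ` P \<longrightarrow> z \<in> (*\<^sub>R) (real c) ` P"
    by (intro eventually_ball_finite) auto
  then show ?thesis
    using eventually_gt_at_top[of 0]
  proof eventually_elim
    case (elim q)
    have "z \<in> F" if "z \<in> int_points" "p \<in> P" "real q *\<^sub>R z + u = real (q * c + M) *\<^sub>R p" for z p
    proof -
      have "W / real q \<le> W / 1" using elim(2) W by (intro divide_left_mono) auto
      moreover have "norm z \<le> norm (z - real c *\<^sub>R p) + norm (real c *\<^sub>R p)"
        using norm_triangle_ineq[of "z - real c *\<^sub>R p" "real c *\<^sub>R p"] by simp
      moreover have "norm (real c *\<^sub>R p) \<le> real c * R" using R(2)[OF that(2)] by (simp add: mult_left_mono)
      ultimately show ?thesis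
        using near[OF elim(2) that(2,3)] that(1) by (simp add: F_def)
    qed
    then show ?case using elim(1) by blast
  qed
qed

lemma piece_Suc_subset_ideal_piece:
  fixes b :: "nat \<Rightarrow> (real^'d) \<Rightarrow>\<^sub>0 'k::alg_closed_field"
  assumes two: "(2::'k) = 0" and P: "convex P" "compact P" "P \<inter> int_points \<noteq> {}"
    and b: "\<And>i. i \<le> d \<Longrightarrow> b i \<in> piece P 1"
    and M: "\<And>r. r \<ge> M \<Longrightarrow> piece P (Suc r) \<subseteq> ideal_piece P (b ` {..d}) (Suc r)"
    and c: "d \<le> c"
  shows "piece P (Suc c) \<subseteq> ideal_piece P (b ` {..d}) (Suc c)"
  unfolding piece_eq_span[of P "Suc c"]
proof (rule pm.span_minimal[OF _ subspace_ideal_piece], safe)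
  fix p assume p: "p \<in> P" "real (Suc c) *\<^sub>R p \<in> int_points"
  define s where "s = real (Suc c) *\<^sub>R p"
  obtain p0 where p0: "p0 \<in> P" "p0 \<in> int_points" using P(3) by auto
  \<comment> \<open>The exponent of the auxiliary monomial \<open>y\<close>; its degree
    \<open>M\<close> pays for the extra \<open>M\<close> in the pigeonhole bound.\<close>
  define u where "u = real M *\<^sub>R p0"
  have u: "u \<in> (*\<^sub>R) (real M) ` P" "u \<in> int_points" using p0 int_points_scale by (auto simp: u_def)
  obtain q0 where q0: "\<And>q z. q \<ge> q0 \<Longrightarrow> z \<in> int_points \<Longrightarrow>
      real q *\<^sub>R z + u \<in> (*\<^sub>R) (real (q * c + M)) ` P \<Longrightarrow> z \<in> (*\<^sub>R) (real c) ` P"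
    using eventually_lattice_point_descends[OF P(2), of u c M] unfolding eventually_sequentially by blast
  \<comment> \<open>Taking the threshold itself as the exponent gives a power of 2 that is at least
    \<open>q0\<close>.\<close>
  define q :: nat where "q = 2 ^ q0"
  have q: "q \<ge> q0" "real q = 2 ^ q0" by (auto simp: q_def less_imp_le less_exp)
  let ?\<phi> = "frobenius_trace q0 u :: ((real^'d) \<Rightarrow>\<^sub>0 'k) \<Rightarrow> _"
  define w where "w = real q *\<^sub>R s + u"
  have "real q *\<^sub>R s \<in> (*\<^sub>R) (real (q * Suc c)) ` P"
    using p by (intro image_eqI[of _ _ p]) (auto simp: s_def algebra_simps)
  then have "w \<in> (*\<^sub>R) (real (q * Suc c + M)) ` P \<inter> int_points"
    using scaled_convex_add[OF P(1) _ u(1)] int_points_add[OF int_points_scale u(2)] p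
    unfolding w_def s_def by blast
  then have "Poly_Mapping.single w (1::'k) \<in> piece P (q * Suc c + M)" by (rule single_in_piece)
  \<comment> \<open>Here \<open>d \<le> c\<close> enters: \<open>d + 1\<close> generators raised to
    the power \<open>q\<close> require degree \<open>(d + 1) * q + M\<close>.\<close>
  moreover have "q * Suc c + M \<ge> M + (\<Sum>i\<le>d. q)"
  proof -
    have "Suc d * q \<le> Suc c * q" using c by (intro mult_right_mono) auto
    then show ?thesis by (simp add: mult.commute)
  qed
  ultimately have "Poly_Mapping.single w (1::'k) \<in> power_ideal_piece P b (\<lambda>_. q) d (q * Suc c + M)"
    using piece_subset_power_ideal_piece[OF P(1) b M, where \<beta> = "\<lambda>_. q"] by blast
  then have "?\<phi> (Poly_Mapping.single w 1) \<in> ideal_piece P (b ` {..d}) (Suc c)"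
    unfolding power_ideal_piece_def
  proof (induction rule: pm.span_induct_alt)
    case base
    have "?\<phi> 0 = 0"
      by (rule poly_mapping_eqI) (simp add: lookup_frobenius_trace[OF two] frobenius_root_0[OF two])
    then show ?case using pm.subspace_0[OF subspace_ideal_piece] by simp
  next
    case (step a x y)
    then obtain i h where x: "x = b i ^ q * h" "i \<le> d" "h \<in> piece P (q * c + M)" by auto
    have "Poly_Mapping.keys (b i) \<subseteq> int_points" using b[OF x(2)] by (auto simp: piece_def)
    then have \<phi>x: "?\<phi> x = b i * ?\<phi> h"
      unfolding x q_def by (rule frobenius_trace_power_mult[OF two])
    \<comment> \<open>The cofactor \<open>h\<close> has degree \<open>q * c + M\<close>; by the
      choice of \<open>q0\<close>, the exponents surviving the trace lie in
      \<open>c P\<close>.\<close>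
    have "z \<in> (*\<^sub>R) (real c) ` P \<inter> int_points" if "z \<in> Poly_Mapping.keys (?\<phi> h)" for z
    proof -
      have "z \<in> int_points" "real q *\<^sub>R z + u \<in> Poly_Mapping.keys h"
        using that frobenius_root_0[OF two]
        by (auto simp: in_keys_iff lookup_frobenius_trace[OF two] q split: if_splits)
      then show ?thesis using q0[OF q(1), of z] x(3) by (auto simp: piece_def)
    qed
    then have "?\<phi> h \<in> piece P c" by (auto simp: piece_def)
    then have "?\<phi> x \<in> ideal_piece P (b ` {..d}) (Suc c)"
      unfolding \<phi>x using x(2) by (intro ideal_piece_base) auto
    then show ?case
      unfolding frobenius_trace_add[OF two] frobenius_trace_scale[OF two]
      using step by (intro pm.subspace_add pm.subspace_scale subspace_ideal_piece)
  qed
  moreover have "?\<phi> (Poly_Mapping.single w 1) = Poly_Mapping.single s 1"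
  proof (rule poly_mapping_eqI)
    fix z
    have "w = 2 ^ q0 *\<^sub>R z + u \<longleftrightarrow> s = z"
      by (simp add: w_def q)
    moreover have "s \<in> int_points" using p by (simp add: s_def)
    ultimately show "Poly_Mapping.lookup (?\<phi> (Poly_Mapping.single w 1)) z = Poly_Mapping.lookup (Poly_Mapping.single s 1) z"
      by (auto simp: lookup_frobenius_trace[OF two] lookup_single when_def frobenius_root_0[OF two]
          frobenius_root_1[OF two])
  qed
  ultimately show "Poly_Mapping.single (real (Suc c) *\<^sub>R p) 1 \<in> ideal_piece P (b ` {..d}) (Suc c)"
    by (simp add: s_def)
qed

section \<open>Counting and spanning by reduced monomials\<close>

lemma finite_lists_sum_eq: "finite {l::nat list. length l = m \<and> sum_list l = k}"
proof (rule finite_subset)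
  show "{l. length l = m \<and> sum_list l = k} \<subseteq> {l. set l \<subseteq> {..k} \<and> length l = m}"
    using member_le_sum_list by fastforce
  show "finite {l. set l \<subseteq> {..k} \<and> length l = m}" by (rule finite_lists_length_eq) simp
qed

text \<open>Stars and bars: a slack entry put in front turns the inequality into the equation that
  the sum is \<open>k\<close>, with \<open>m + 1\<close> entries.\<close>

lemma bounded_exponents:
  fixes m k :: nat
  defines "A \<equiv> {\<alpha>::nat \<Rightarrow> nat. (\<forall>i\<ge>m. \<alpha> i = 0) \<and> (\<Sum>i<m. \<alpha> i) \<le> k}"
  shows "finite A" "card A \<le> (k + m) choose k"
proof -
  define F where "F = (\<lambda>\<alpha>::nat \<Rightarrow> nat. (k - (\<Sum>i<m. \<alpha> i)) # map \<alpha> [0..<m])"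
  have inj: "inj_on F A"
  proof (rule inj_onI, rule ext)
    fix \<alpha> \<beta> i assume *: "\<alpha> \<in> A" "\<beta> \<in> A" "F \<alpha> = F \<beta>"
    then have "\<forall>i<m. \<alpha> i = \<beta> i" by (simp add: F_def)
    then show "\<alpha> i = \<beta> i" using * by (cases "i < m") (auto simp: A_def)
  qed
  have sub: "F ` A \<subseteq> {l. length l = Suc m \<and> sum_list l = k}"
    by (auto simp: F_def A_def interv_sum_list_conv_sum_set_nat atLeast0LessThan)
  show "finite A" using inj_on_finite[OF inj sub finite_lists_sum_eq] .
  have "card A \<le> card {l::nat list. length l = Suc m \<and> sum_list l = k}"
    by (rule card_inj_on_le[OF inj sub finite_lists_sum_eq])
  then show "card A \<le> (k + m) choose k" by (simp add: card_length_sum_list)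
qed

text \<open>Exponents of degree \<open>c\<close> monomials whose degree in the generators outside
  the normalization is at most \<open>d\<close>. Requiring zeros from \<open>n\<close> on makes
  distinct functions distinct monomials in the variables.\<close>

definition reduced_exponents :: "nat \<Rightarrow> nat \<Rightarrow> nat \<Rightarrow> (nat \<Rightarrow> nat) set" where
  "reduced_exponents n d c =
     {\<alpha>. (\<forall>i\<ge>n. \<alpha> i = 0) \<and> (\<Sum>i<n. \<alpha> i) = c \<and> (\<Sum>i\<in>{Suc d..<n}. \<alpha> i) \<le> d}"

text \<open>The entry at \<open>d\<close> is determined by the total degree \<open>c\<close> and can
  be forgotten. What remains is a vector of \<open>n - d - 1\<close> entries with sum at most
  \<open>d\<close> and one of \<open>d\<close> entries with sum at most \<open>c\<close>; stars and
  bars gives the two factors.\<close>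

lemma reduced_exponents_card:
  assumes "d < n"
  shows "finite (reduced_exponents n d c)"
    and "card (reduced_exponents n d c) \<le> ((n - 1) choose d) * ((c + d) choose d)"
proof -
  define A where "A m k = {\<alpha>::nat \<Rightarrow> nat. (\<forall>i\<ge>m. \<alpha> i = 0) \<and> (\<Sum>i<m. \<alpha> i) \<le> k}" for m k
  define F where "F = (\<lambda>(\<alpha>::nat \<Rightarrow> nat).
    (\<lambda>i. if i < n - Suc d then \<alpha> (i + Suc d) else 0, \<lambda>i. if i < d then \<alpha> i else 0))"
  have split: "(\<Sum>i<n. \<alpha> i) = (\<Sum>i<d. \<alpha> i) + \<alpha> d + (\<Sum>i\<in>{Suc d..<n}. \<alpha> i)" for \<alpha> :: "nat \<Rightarrow> nat"
  proof -
    have "{..<n} = {..<Suc d} \<union> {Suc d..<n}" using assms by auto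
    then have "(\<Sum>i<n. \<alpha> i) = (\<Sum>i<Suc d. \<alpha> i) + (\<Sum>i\<in>{Suc d..<n}. \<alpha> i)"
      by (simp add: sum.union_disjoint ivl_disj_int(2))
    then show ?thesis by simp
  qed
  have shift: "(\<Sum>i<n - Suc d. \<alpha> (i + Suc d)) = (\<Sum>i\<in>{Suc d..<n}. \<alpha> i)" for \<alpha> :: "nat \<Rightarrow> nat"
    using assms sum.shift_bounds_nat_ivl[of \<alpha> 0 "Suc d" "n - Suc d"] by (simp add: atLeast0LessThan)
  have inj: "inj_on F (reduced_exponents n d c)"
  proof (rule inj_onI, rule ext)
    fix \<alpha> \<beta> i
    assume *: "\<alpha> \<in> reduced_exponents n d c" "\<beta> \<in> reduced_exponents n d c" "F \<alpha> = F \<beta>"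
    have lo: "\<alpha> i = \<beta> i" if "i < d" for i
      using *(3) that by (auto simp: F_def dest!: fun_cong[of _ _ i])
    have hi: "\<alpha> i = \<beta> i" if "i > d" for i
    proof (cases "i < n")
      case True
      then have "i - Suc d < n - Suc d" "i - Suc d + Suc d = i" using that by auto
      then show ?thesis
        using *(3) unfolding F_def prod.inject by (metis (mono_tags, lifting))
    next
      case False
      then show ?thesis using * by (auto simp: reduced_exponents_def)
    qed
    have "(\<Sum>i<d. \<alpha> i) = (\<Sum>i<d. \<beta> i)" by (rule sum.cong) (auto simp: lo)
    moreover have "(\<Sum>i\<in>{Suc d..<n}. \<alpha> i) = (\<Sum>i\<in>{Suc d..<n}. \<beta> i)" by (rule sum.cong) (auto simp: hi)
    moreover have "(\<Sum>i<n. \<alpha> i) = (\<Sum>i<n. \<beta> i)" using * by (auto simp: reduced_exponents_def)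
    ultimately have "\<alpha> d = \<beta> d" unfolding split by linarith
    then show "\<alpha> i = \<beta> i" using lo hi by (metis linorder_neqE_nat)
  qed
  have sub: "F ` reduced_exponents n d c \<subseteq> A (n - Suc d) d \<times> A d c"
  proof
    fix x assume "x \<in> F ` reduced_exponents n d c"
    then obtain \<alpha> where \<alpha>: "\<alpha> \<in> reduced_exponents n d c" "x = F \<alpha>" by auto
    have "(\<Sum>i<n - Suc d. if i < n - Suc d then \<alpha> (i + Suc d) else 0) \<le> d"
      using \<alpha>(1) shift[of \<alpha>] by (simp add: reduced_exponents_def)
    moreover have "(\<Sum>i<d. if i < d then \<alpha> i else 0) \<le> c"
      using \<alpha>(1) split[of \<alpha>] by (simp add: reduced_exponents_def)
    ultimately show "x \<in> A (n - Suc d) d \<times> A d c"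
      unfolding \<alpha>(2) F_def A_def by simp
  qed
  have fin: "finite (A (n - Suc d) d \<times> A d c)"
    unfolding A_def by (intro finite_cartesian_product bounded_exponents)
  show "finite (reduced_exponents n d c)" by (rule inj_on_finite[OF inj sub fin])
  have "card (reduced_exponents n d c) \<le> card (A (n - Suc d) d \<times> A d c)"
    by (rule card_inj_on_le[OF inj sub fin])
  also have "\<dots> \<le> ((d + (n - Suc d)) choose d) * ((c + d) choose c)"
    unfolding card_cartesian_product A_def by (intro mult_mono bounded_exponents) auto
  also have "\<dots> = ((n - 1) choose d) * ((c + d) choose d)"
    using assms binomial_symmetric[of c "c + d"] by simp
  finally show "card (reduced_exponents n d c) \<le> ((n - 1) choose d) * ((c + d) choose d)" .
qed

text \<open>Induction on the degree. Above degree \<open>d\<close>, elements are combinations of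
  \<open>b i * h\<close> with \<open>i \<le> d\<close>, and such a factor leaves the restricted
  degree unchanged. Up to degree \<open>d\<close> every monomial is reduced, and generation in
  degree 1 suffices.\<close>

lemma piece_subset_span_reduced_monomials:
  fixes b :: "nat \<Rightarrow> (real^'d) \<Rightarrow>\<^sub>0 'k::field"
  assumes P: "convex P" "P \<noteq> {}" "integrally_closed P"
    and b: "piece P 1 \<subseteq> pm.span (b ` {..<n})" and d: "d < n"
    and red: "\<And>c. d \<le> c \<Longrightarrow> piece P (Suc c) \<subseteq> ideal_piece P (b ` {..d}) (Suc c)"
  shows "piece P c \<subseteq> pm.span ((\<lambda>\<alpha>. \<Prod>i<n. b i ^ \<alpha> i) ` reduced_exponents n d c)"
proof (induction c)
  case 0
  have "(\<lambda>_. 0) \<in> reduced_exponents n d 0" by (simp add: reduced_exponents_def)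
  then have "1 \<in> (\<lambda>\<alpha>. \<Prod>i<n. b i ^ \<alpha> i) ` reduced_exponents n d 0"
    by (rule rev_image_eqI) simp
  moreover have "piece P 0 = pm.span {1 :: (real^'d) \<Rightarrow>\<^sub>0 'k}"
    unfolding piece_eq_span using P(2) by (simp add: image_constant_conv int_points_0)
  ultimately show ?case
    using pm.span_mono[of "{1}" "(\<lambda>\<alpha>. \<Prod>i<n. b i ^ \<alpha> i) ` reduced_exponents n d 0"] by simp
next
  case (Suc c)
  let ?T = "\<lambda>c. (\<lambda>\<alpha>. \<Prod>i<n. b i ^ \<alpha> i) ` reduced_exponents n d c"
  \<comment> \<open>Covers both cases: either the restricted sum does not change, or it is bounded
    by the total degree \<open>c + 1 \<le> d\<close>.\<close>
  have step: "b i * f \<in> pm.span (?T (Suc c))"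
    if i: "i < n" "i \<le> d \<or> c < d" and f: "f \<in> piece P c" for i f
  proof (rule mult_span_subset[OF subsetD[OF Suc f] pm.subspace_span])
    fix x assume "x \<in> ?T c"
    then obtain \<alpha> where \<alpha>: "\<alpha> \<in> reduced_exponents n d c" "x = (\<Prod>i<n. b i ^ \<alpha> i)" by auto
    define \<alpha>' where "\<alpha>' = \<alpha>(i := Suc (\<alpha> i))"
    have "b i * x = (\<Prod>j<n. b j ^ \<alpha>' j)"
    proof -
      have "(\<Prod>j<n. b j ^ \<alpha>' j) = b i ^ Suc (\<alpha> i) * (\<Prod>j\<in>{..<n} - {i}. b j ^ \<alpha>' j)"
        using i by (simp add: prod.remove[of _ i] \<alpha>'_def)
      also have "(\<Prod>j\<in>{..<n} - {i}. b j ^ \<alpha>' j) = (\<Prod>j\<in>{..<n} - {i}. b j ^ \<alpha> j)"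
        by (rule prod.cong) (auto simp: \<alpha>'_def)
      also have "b i ^ Suc (\<alpha> i) * \<dots> = b i * x"
        using i by (simp add: \<alpha>(2) prod.remove[of _ i] mult.assoc)
      finally show ?thesis ..
    qed
    moreover have "\<alpha>' \<in> reduced_exponents n d (Suc c)"
    proof -
      have sum': "sum \<alpha>' S = (if i \<in> S then Suc (sum \<alpha> S) else sum \<alpha> S)" if "finite S" for S
      proof -
        have "sum \<alpha>' (S - {i}) = sum \<alpha> (S - {i})" by (rule sum.cong) (auto simp: \<alpha>'_def)
        then show ?thesis
          using that by (cases "i \<in> S") (simp_all add: sum.remove[of S i] \<alpha>'_def)
      qed
      have "(\<Sum>j\<in>{Suc d..<n}. \<alpha> j) \<le> (\<Sum>j<n. \<alpha> j)" by (rule sum_mono2) auto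
      moreover have "\<forall>j\<ge>n. \<alpha>' j = 0"
        using \<alpha>(1) i by (auto simp: reduced_exponents_def \<alpha>'_def)
      ultimately show ?thesis
        using \<alpha>(1) i unfolding reduced_exponents_def by (auto simp: sum')
    qed
    ultimately show "b i * x \<in> pm.span (?T (Suc c))" by (auto intro: pm.span_base)
  qed
  show ?case
  proof (cases "d \<le> c")
    case True
    have "ideal_piece P (b ` {..d}) (Suc c) \<subseteq> pm.span (?T (Suc c))"
      unfolding ideal_piece_def
    proof (rule pm.span_minimal[OF _ pm.subspace_span], intro subsetI)
      fix f :: "(real^'d) \<Rightarrow>\<^sub>0 'k"
      assume "f \<in> {b' * h |b' h j. b' \<in> b ` {..d} \<and> h \<in> piece P j \<and> Suc c = Suc j}"
      then obtain i h where "f = b i * h" "i \<le> d" "h \<in> piece P c" by auto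
      then show "f \<in> pm.span (?T (Suc c))" using step[of i h] d by simp
    qed
    then show ?thesis using red[OF True] by blast
  next
    case False
    show ?thesis
      unfolding piece_eq_span[of P "Suc c"]
    proof (rule pm.span_minimal[OF _ pm.subspace_span], intro subsetI)
      fix f :: "(real^'d) \<Rightarrow>\<^sub>0 'k"
      assume "f \<in> (\<lambda>z. Poly_Mapping.single z 1) ` ((*\<^sub>R) (real (Suc c)) ` P \<inter> int_points)"
      then obtain z where z: "f = Poly_Mapping.single z 1" "z \<in> (*\<^sub>R) (real (Suc c)) ` P \<inter> int_points"
        by auto
      obtain a y where ay: "a \<in> P \<inter> int_points" "y \<in> (*\<^sub>R) (real c) ` P \<inter> int_points" "z = a + y"
        using integrally_closed_decompose[OF P(3,1,2) z(2)] by blast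
      have "Poly_Mapping.single a 1 \<in> pm.span (b ` {..<n})"
        using b single_in_piece[of a 1 P 1] ay(1) by auto
      then have "Poly_Mapping.single y 1 * Poly_Mapping.single a 1 \<in> pm.span (?T (Suc c))"
      proof (rule mult_span_subset[OF _ pm.subspace_span])
        fix x assume "x \<in> b ` {..<n}"
        then show "Poly_Mapping.single y 1 * x \<in> pm.span (?T (Suc c))"
          using step[OF _ _ single_in_piece[OF ay(2)]] False by (auto simp: mult.commute)
      qed
      then show "f \<in> pm.span (?T (Suc c))" by (simp add: z ay(3) mult_single add.commute)
    qed
  qed
qed

section \<open>Upper bound for the lattice points of the dilates\<close>

lemma inj_on_single_one: "inj_on (\<lambda>z. Poly_Mapping.single z (1::'k::zero_neq_one)) Z"
proof (rule inj_onI)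
  fix x y assume "Poly_Mapping.single x (1::'k) = Poly_Mapping.single y 1"
  then have "Poly_Mapping.keys (Poly_Mapping.single x (1::'k)) = Poly_Mapping.keys (Poly_Mapping.single y (1::'k))"
    by simp
  then show "x = y" by simp
qed

lemma independent_single:
  fixes Z :: "'a::comm_monoid_add set"
  assumes "finite Z"
  shows "pm.independent ((\<lambda>z. Poly_Mapping.single z (1::'k::field)) ` Z)" (is "pm.independent ?M")
proof
  assume "pm.dependent ?M"
  then obtain u z where u: "z \<in> Z" "u (Poly_Mapping.single z 1) \<noteq> 0" "(\<Sum>v\<in>?M. const (u v) * v) = 0"
    using pm.dependent_finite[of ?M] assms by auto
  then have "0 = Poly_Mapping.lookup (\<Sum>w\<in>Z. const (u (Poly_Mapping.single w 1)) * Poly_Mapping.single w 1) z"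
    by (simp add: sum.reindex[OF inj_on_single_one])
  also have "\<dots> = (\<Sum>w\<in>Z. if w = z then u (Poly_Mapping.single w 1) else 0)"
    by (simp add: lookup_sum lookup_const_mult lookup_single when_def if_distrib cong: if_cong)
  also have "\<dots> = u (Poly_Mapping.single z 1)" using u(1) assms by simp
  finally show False using u(2) by simp
qed

lemma two_eq_0_bit_closure: "(2 :: bit alg_closure) = 0"
proof -
  have "(2::bit) = 0" by simp
  then have "to_ac (2::bit) = 0" by (simp only: to_ac_0)
  then show ?thesis by (simp only: to_ac_numeral)
qed

lemma compact_scaled_lattice_points:
  fixes P :: "(real^'d) set"
  assumes "compact P"
  shows "\<exists>K. \<forall>e. finite ((*\<^sub>R) (real e) ` P \<inter> int_points) \<and>
    card ((*\<^sub>R) (real e) ` P \<inter> int_points) \<le> K * (e + 1) ^ CARD('d)"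
proof -
  let ?d = "CARD('d)"
  let ?Z = "\<lambda>c. (*\<^sub>R) (real c) ` P \<inter> int_points"
  obtain R0 where R0: "\<And>p. p \<in> P \<Longrightarrow> norm p \<le> R0"
    using compact_imp_bounded[OF assms] bounded_iff by blast
  obtain R :: nat where "R0 \<le> real R" using real_arch_simple by blast
  then have R: "norm p \<le> real R" if "p \<in> P" for p using R0[OF that] by simp
  have bound: "\<bar>vec_nth x i\<bar> \<le> real (R * e)" if x: "x \<in> ?Z e" for x e i
  proof -
    obtain p where p: "p \<in> P" "x = real e *\<^sub>R p" using x by auto
    have "\<bar>vec_nth x i\<bar> \<le> norm x" by (rule component_le_norm_cart)
    also have "\<dots> \<le> real e * real R" using R[OF p(1)] p(2) by (simp add: mult_left_mono)
    finally show ?thesis by (simp add: mult.commute)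
  qed
  have fin: "finite (?Z e)" for e by (rule bounded_int_points(1)[OF _ bound]) auto
  have card: "card (?Z e) \<le> (2 * R + 1) ^ ?d * (e + 1) ^ ?d" for e
  proof -
    have "card (?Z e) \<le> (2 * (R * e) + 1) ^ ?d" by (rule bounded_int_points(2)[OF _ bound]) auto
    also have "\<dots> \<le> ((2 * R + 1) * (e + 1)) ^ ?d" by (intro power_mono) auto
    finally show ?thesis by (simp only: power_mult_distrib)
  qed
  show ?thesis using fin card by blast
qed

lemma card_lattice_points_le:
  fixes P :: "(real^'d) set"
  assumes P: "convex P" "compact P" "P \<inter> int_points \<noteq> {}" "integrally_closed P"
    and n: "n = card (P \<inter> int_points)" "CARD('d) < n"
  shows "card ((*\<^sub>R) (real c) ` P \<inter> int_points)
    \<le> ((n - 1) choose CARD('d)) * ((c + CARD('d)) choose CARD('d))"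
proof -
  let ?d = "CARD('d)"
  let ?Z = "\<lambda>c. (*\<^sub>R) (real c) ` P \<inter> int_points"
  have ne: "P \<noteq> {}" using P(3) by auto
  obtain K where fin: "\<And>e. finite (?Z e)" and card: "\<And>e. card (?Z e) \<le> K * (e + 1) ^ ?d"
    using compact_scaled_lattice_points[OF P(2)] by blast
  \<comment> \<open>The field is now fixed as an algebraic closure of the field with two elements:
    characteristic 2 serves the Frobenius maps, algebraic closedness the non-roots and the
    \<open>q\<close>-th roots.\<close>
  obtain b :: "nat \<Rightarrow> (real^'d) \<Rightarrow>\<^sub>0 bit alg_closure" and M where
    noether: "b ` {..<n} \<subseteq> piece P 1 \<and> piece P 1 \<subseteq> pm.span (b ` {..<n}) \<and>
      (\<forall>r\<ge>M. piece P (Suc r) \<subseteq> ideal_piece P (b ` {..?d}) (Suc r))"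
    using exists_noether_normalization[OF P(1) ne P(4) fin card n, where 'k = "bit alg_closure"]
    by (elim exE) (rule that)
  note b = conjunct1[OF noether] conjunct1[OF conjunct2[OF noether]]
  note M = conjunct2[OF conjunct2[OF noether], rule_format]
  have bi: "b i \<in> piece P 1" if "i \<le> ?d" for i using b(1) that n(2) by auto
  let ?M = "(\<lambda>z. Poly_Mapping.single z (1::bit alg_closure)) ` ?Z c"
  let ?T = "(\<lambda>\<alpha>. \<Prod>i<n. b i ^ \<alpha> i) ` reduced_exponents n ?d c"
  have "?M \<subseteq> piece P c" by (auto intro: single_in_piece)
  also have "\<dots> \<subseteq> pm.span ?T"
    by (rule piece_subset_span_reduced_monomials[OF P(1) ne P(4) b(2) n(2)])
      (rule piece_Suc_subset_ideal_piece[OF two_eq_0_bit_closure P(1-3) bi M])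
  finally have sub: "?M \<subseteq> pm.span ?T" .
  have "finite ?T" by (rule finite_imageI[OF reduced_exponents_card(1)[OF n(2)]])
  from conjunct2[OF pm.independent_span_bound[OF this independent_single[OF fin] sub]]
  have "card ?M \<le> card ?T" .
  also have "\<dots> \<le> card (reduced_exponents n ?d c)"
    by (rule card_image_le[OF reduced_exponents_card(1)[OF n(2)]])
  also have "\<dots> \<le> ((n - 1) choose ?d) * ((c + ?d) choose ?d)"
    by (rule reduced_exponents_card(2)[OF n(2)])
  finally show ?thesis
    by (simp only: card_image[OF inj_on_single_one])
qed

section \<open>Lower bound for the lattice points by volume\<close>

text \<open>Unit cubes at the rounded-down points of \<open>c P\<close> cover \<open>c P\<close>, so
  there are at least as many of these points as the volume. They may leave \<open>c P\<close>, but
  after translation by \<open>t\<close> they lie in \<open>(c + K) P\<close>: a ball inside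
  \<open>P\<close>, scaled by \<open>K\<close>, absorbs the rounding errors.\<close>

lemma compact_convex_lattice_points_ge:
  fixes P :: "(real^'d) set"
  assumes "convex P" "compact P" "interior P \<noteq> {}"
    and fin: "\<And>c. finite ((*\<^sub>R) (real c) ` P \<inter> int_points)"
  shows "\<exists>K. \<forall>c. real c ^ CARD('d) * measure lebesgue P \<le> real (card ((*\<^sub>R) (real (c + K)) ` P \<inter> int_points))"
proof -
  obtain p0 \<rho> where \<rho>: "\<rho> > 0" "cball p0 \<rho> \<subseteq> P"
    using assms(3) mem_interior_cball by (metis ex_in_conv)
  define D where "D = real CARD('d)"
  have D: "norm x \<le> D" if "\<And>i. \<bar>vec_nth x i\<bar> \<le> 1" for x :: "real^'d"
  proof -
    have "norm x \<le> (\<Sum>i\<in>UNIV. \<bar>vec_nth x i\<bar>)" by (rule norm_le_l1_cart)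
    also have "\<dots> \<le> (\<Sum>i\<in>(UNIV::'d set). 1)" by (intro sum_mono that)
    finally show ?thesis by (simp add: D_def)
  qed
  define fl :: "real^'d \<Rightarrow> real^'d" where "fl x = (\<chi> i. of_int \<lfloor>vec_nth x i\<rfloor>)" for x
  have fl_int: "fl x \<in> int_points" for x by (simp add: fl_def int_points_def)
  have fl_near: "norm (fl x - x) \<le> D" for x
  proof (rule D)
    fix i show "\<bar>vec_nth (fl x - x) i\<bar> \<le> 1"
      using of_int_floor_le[of "vec_nth x i"] real_of_int_floor_add_one_gt[of "vec_nth x i"]
      unfolding fl_def by simp linarith
  qed
  \<comment> \<open>The scaled ball must have radius at least \<open>2 * D\<close>: one
    \<open>D\<close> for rounding \<open>x\<close>, one for rounding \<open>K p0\<close> to the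
    lattice point \<open>t\<close>. The successor in \<open>K\<close> keeps it positive.\<close>
  obtain K0 :: nat where K0: "2 * D / \<rho> \<le> real K0" using real_arch_simple by blast
  define K where "K = Suc K0"
  have K: "2 * D \<le> real K * \<rho>" "real K > 0"
    using K0 \<rho>(1) by (auto simp: K_def field_simps)
  define t where "t = fl (real K *\<^sub>R p0)"
  have shift: "fl x + t \<in> (*\<^sub>R) (real (c + K)) ` P \<inter> int_points" if "x \<in> (*\<^sub>R) (real c) ` P" for x c
  proof -
    define e where "e = (fl x - x) + (t - real K *\<^sub>R p0)"
    have "norm e \<le> norm (fl x - x) + norm (t - real K *\<^sub>R p0)"
      unfolding e_def by (rule norm_triangle_ineq)
    also have "\<dots> \<le> real K * \<rho>"
      using fl_near[of x] fl_near[of "real K *\<^sub>R p0"] K(1) by (simp add: t_def)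
    finally have "norm ((1 / real K) *\<^sub>R e) \<le> \<rho>" using K(2) by (simp add: field_simps)
    then have "p0 + (1 / real K) *\<^sub>R e \<in> P" using \<rho>(2) by (auto simp: dist_norm)
    moreover have "real K *\<^sub>R (p0 + (1 / real K) *\<^sub>R e) = real K *\<^sub>R p0 + e"
      using K(2) by (simp add: scaleR_add_right)
    ultimately have "real K *\<^sub>R p0 + e \<in> (*\<^sub>R) (real K) ` P" by (metis imageI)
    from scaled_convex_add[OF assms(1) that this] have "x + (real K *\<^sub>R p0 + e) \<in> (*\<^sub>R) (real (c + K)) ` P" .
    also have "x + (real K *\<^sub>R p0 + e) = fl x + t" by (simp add: e_def)
    finally show ?thesis using int_points_add[OF fl_int fl_int] by (simp add: t_def)
  qed
  have "real c ^ CARD('d) * measure lebesgue P \<le> real (card ((*\<^sub>R) (real (c + K)) ` P \<inter> int_points))" for c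
  proof -
    let ?S = "fl ` (*\<^sub>R) (real c) ` P"
    let ?cube = "\<lambda>z::real^'d. cbox z (z + 1)"
    have sub: "(\<lambda>z. z + t) ` ?S \<subseteq> (*\<^sub>R) (real (c + K)) ` P \<inter> int_points" using shift by auto
    have finS: "finite ?S" by (rule inj_on_finite[OF _ sub fin]) simp
    have cube: "measure lebesgue (?cube z) = 1" for z
    proof -
      have "cbox z (z + 1) \<noteq> {}" by (auto simp: interval_ne_empty_cart)
      then have "measure lborel (cbox z (z + 1)) = 1" by (simp add: content_cbox_cart)
      then show ?thesis by (simp add: measure_completion)
    qed
    have "real c ^ CARD('d) * measure lebesgue P = measure lebesgue ((*\<^sub>R) (real c) ` P)"
      using measure_lebesgue_affine[of "real c" 0 P] by simp
    also have "\<dots> \<le> measure lebesgue (\<Union>z\<in>?S. ?cube z)"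
    proof (rule measure_mono_fmeasurable)
      show "(*\<^sub>R) (real c) ` P \<subseteq> (\<Union>z\<in>?S. ?cube z)"
      proof
        fix x assume "x \<in> (*\<^sub>R) (real c) ` P"
        moreover have "x \<in> ?cube (fl x)"
        proof -
          have "vec_nth (fl x) i \<le> vec_nth x i \<and> vec_nth x i \<le> vec_nth (fl x) i + 1" for i
            using floor_correct[of "vec_nth x i"] by (simp add: fl_def)
          then show ?thesis by (simp add: mem_box_cart)
        qed
        ultimately show "x \<in> (\<Union>z\<in>?S. ?cube z)" by blast
      qed
      show "(*\<^sub>R) (real c) ` P \<in> sets lebesgue"
        by (intro fmeasurableD lmeasurable_compact compact_scaling assms)
      show "(\<Union>z\<in>?S. ?cube z) \<in> lmeasurable"
        by (intro fmeasurable.finite_UN finS) auto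
    qed
    also have "\<dots> \<le> (\<Sum>z\<in>?S. measure lebesgue (?cube z))"
      by (rule measure_UNION_le[OF finS]) auto
    also have "\<dots> = real (card ?S)" by (simp add: cube)
    also have "card ?S \<le> card ((*\<^sub>R) (real (c + K)) ` P \<inter> int_points)"
      by (rule card_inj_on_le[OF _ sub fin]) simp
    finally show ?thesis by simp
  qed
  then show ?thesis by blast
qed

section \<open>Comparison of leading terms and conclusion\<close>

text \<open>Since \<open>d!\<close> times a binomial coefficient \<open>N choose d\<close> is at
  most \<open>N ^ d\<close>, dividing by \<open>c ^ d\<close> and letting \<open>c\<close> tend to
  infinity removes the shift \<open>K + d\<close>.\<close>

lemma fact_mult_le_of_choose_bound:
  fixes v :: real
  assumes "\<And>c. real c ^ d * v \<le> real (B * ((c + K + d) choose d))"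
  shows "fact d * v \<le> real B"
proof (rule LIMSEQ_le_const)
  have "(\<lambda>c. 1 + real (K + d) / real c) \<longlonglongrightarrow> 1" by real_asymp
  then have "(\<lambda>c. real B * (1 + real (K + d) / real c) ^ d) \<longlonglongrightarrow> real B * 1 ^ d"
    by (intro tendsto_intros)
  then show "(\<lambda>c. real B * (1 + real (K + d) / real c) ^ d) \<longlonglongrightarrow> real B" by simp
  have "fact d * v \<le> real B * (1 + real (K + d) / real c) ^ d" if "c \<ge> 1" for c
  proof -
    have "real c ^ d * (fact d * v) = fact d * (real c ^ d * v)" by simp
    also have "\<dots> \<le> fact d * real (B * ((c + K + d) choose d))"
      by (intro mult_left_mono assms) simp
    also have "\<dots> = real B * real (((c + K + d) choose d) * fact d)" by simp
    also have "\<dots> \<le> real B * real ((c + K + d) ^ d)"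
      using binomial_fact_pow[of "c + K + d" d] by (intro mult_left_mono of_nat_mono) auto
    also have "\<dots> = real c ^ d * (real B * (1 + real (K + d) / real c) ^ d)"
    proof -
      have "real (c + K + d) = real c * (1 + real (K + d) / real c)"
        using that by (simp add: field_simps)
      then show ?thesis by (simp only: of_nat_power power_mult_distrib mult_ac)
    qed
    finally show ?thesis using that by simp
  qed
  then show "\<exists>N. \<forall>c\<ge>N. fact d * v \<le> real B * (1 + real (K + d) / real c) ^ d" by blast
qed

theorem corollary1p5:
  fixes P :: "(real ^ 'd) set" and n :: nat
  assumes "lattice_polytope P"
    and "aff_dim P = int CARD('d)"
    and "integrally_closed P"
    and "n = card (P \<inter> int_points)"
  shows "fact CARD('d) * measure lebesgue P \<le> real ((n - 1) choose CARD('d))"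
proof -
  obtain S where S: "finite S" "S \<subseteq> int_points" "P = convex hull S"
    using assms(1) by (auto simp: lattice_polytope_def)
  have convex: "convex P" and compact: "compact P"
    using S by (auto simp: finite_imp_compact_convex_hull)
  have "P \<noteq> {}" using assms(2) by auto
  then have ne: "P \<inter> int_points \<noteq> {}"
    using S hull_subset[of S convex] by (metis Int_iff convex_hull_eq_empty empty_iff ex_in_conv subsetD)
  have "rel_interior P = interior P"
    using interior_rel_interior_gen[of P] assms(2) by simp
  then have interior: "interior P \<noteq> {}"
    using rel_interior_eq_empty[OF convex] \<open>P \<noteq> {}\<close> by simp
  obtain L where L: "\<forall>e. finite ((*\<^sub>R) (real e) ` P \<inter> int_points) \<and>
      card ((*\<^sub>R) (real e) ` P \<inter> int_points) \<le> L * (e + 1) ^ CARD('d)"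
    using compact_scaled_lattice_points[OF compact] by (elim exE)
  then have fin: "finite ((*\<^sub>R) (real e) ` P \<inter> int_points)" for e by simp
  \<comment> \<open>Full dimension forces at least \<open>d + 1\<close> points in \<open>S\<close>,
    hence enough lattice points for \<open>d + 1\<close> generators.\<close>
  have "int CARD('d) \<le> int (card S) - 1"
    using aff_dim_le_card[OF S(1)] assms(2) unfolding S(3) aff_dim_convex_hull by simp
  moreover have "card S \<le> n"
    unfolding assms(4) using fin[of 1] S hull_subset[of S convex] by (intro card_mono) auto
  ultimately have n: "CARD('d) < n" by linarith
  obtain K where K: "\<forall>c. real c ^ CARD('d) * measure lebesgue P
      \<le> real (card ((*\<^sub>R) (real (c + K)) ` P \<inter> int_points))"
    using compact_convex_lattice_points_ge[OF convex compact interior fin] by (elim exE)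
  have "real c ^ CARD('d) * measure lebesgue P
      \<le> real (((n - 1) choose CARD('d)) * ((c + K + CARD('d)) choose CARD('d)))" for c
    using K[rule_format, of c]
      of_nat_mono[OF card_lattice_points_le[OF convex compact ne assms(3,4) n, of "c + K"]]
    by (rule order_trans)
  then show ?thesis by (rule fact_mult_le_of_choose_bound)
qed

end
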